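(* Let $\phi\colon\Gamma\to B$ be a strong formal subdivision of rank $0$, where $\Gamma$ is a lower Eulerian poset and $B$ is an Eulerian poset. Then \[\varrho(\Omega_\phi)=\sum_{x\in B}\Omega_{\phi_x}\otimes\Phi_{[x,\hat 1]},\] where $\phi_x\colon\Gamma_x\to[\hat 0,x]$ is the restriction of $\phi$ to $\Gamma_x=\{y\in\Gamma\mid\phi(y)\le x\}$.
   Context: Posets. All posets are finite and graded (all maximal chains have the same length, called the rank) with a unique minimal element $\hat 0$; $\hat 1$ is the unique maximal element if it exists; $\rho(x)=\mathrm{rank}([\hat 0,x])$. The boundary $\partial P$ of a poset of rank $n$ is the lower order ideal generated by the rank $n-1$ elements covered by exactly one element. $P$ is Eulerian if it has $\hat 0,\hat 1$ and every interval of positive rank has as many elements of even rank as of odd rank; lower Eulerian if it has $\hat 0$ and every interval is Eulerian; a rank $n$ poset $P$ is near-Eulerian if $P=Q\setminus\{q,\hat 1\}$ with $Q$ Eulerian of rank $n+1$ and $q\in Q$ of rank $n$. The semisuspension $\widetilde\Sigma P$ of a rank $n$ poset is $P\cup\{q\}$ with a new rank $n$ element $q$ lying above exactly the elements of $\partial P$. $cd$-index. $\mathbf K$ is a field of characteristic $0$. For $P$ of rank $n$, $\Psi_P=\sum_{S\subseteq[n]}\beta_P(S)u_S\in\mathbf K\langle a,b\rangle$, where $\beta_P(S)=\sum_{T\subseteq S}(-1)^{\#(S\setminus T)}\alpha_P(T)$, $\alpha_P(T)$ is the number of chains $\hat 0<x_1<\dots<x_k$ with $\{\rho(x_i)\}=T$,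 and $u_S=u_1\cdots u_n$ with $u_i=b$ if $i\in S$, $u_i=a$ otherwise. If $Q$ is the boundary of an Eulerian poset of positive rank, $\Phi_Q(c,d)$ is the unique polynomial with $\Phi_Q(a+b,ab+ba)=\Psi_Q$ (so it is $1$ for $Q=\partial P$ with $P$ of rank $1$). For near-Eulerian $P$ the local $cd$-index is $\ell^\Phi_P=\Phi_{\widetilde\Sigma P}-\Phi_{\partial P}\cdot c$ (here $\widetilde\Sigma P$ and $\partial P$ are boundaries of Eulerian posets); for the singleton poset it is $1$. For an Eulerian poset $P$ of positive rank $\Phi_P:=\Phi_{\partial P}$; for an Eulerian poset of rank $0$ (singleton), $\Phi_P:=e$, where $e$ is a new symbol. Spaces. With $c=a+b$, $d=ab+ba$, $R_\Phi=\mathbf K\langle c,d\rangle\subset R_\Psi=\mathbf K\langle a,b\rangle$. $R^e_\Psi$ is the quotient of $\mathbf K\langle a,b,e\rangle$ by the two-sided ideal generated by $e^2,ea,eb,ae,be$ (underlying vector space $R_\Psi\oplus\mathbf Ke$), and $R^e_\Phi=R_\Phi\oplus\mathbf Ke\subset R^e_\Psi$. $R'_\Phi=\mathbf K\langle c',d'\rangle$ is a primed copy of $R_\Phi$, and $R_\Omega=R'_\Phi\otimes_{\mathbf K}R^e_\Phi$, writing $w'\cdot w$ for $w'\otimes w$. The coproduct $\Delta\colon R^e_\Psi\to R^e_\Psi\otimes R^e_\Psi$ is linear with $\Delta(e)=e\otimes e$ and, for a monomial $w=w_1\cdots w_n$ in $a,b$, $\Delta(w)=e\otimes w+\sum_{i=1}^n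 w_1\cdots w_{i-1}\otimes w_{i+1}\cdots w_n+w\otimes e$; it restricts to $R^e_\Phi\to R^e_\Phi\otimes R^e_\Phi$. The map $\varrho\colon R_\Omega\to R_\Omega\otimes R^e_\Phi$ is linear with $\varrho(w'\cdot w)=w'\cdot\Delta(w)$ for $w'\in R'_\Phi$ and $w\in R^e_\Phi$, where $w'\cdot(w_1\otimes w_2)=(w'\cdot w_1)\otimes w_2$. Strong formal subdivisions. A strong formal subdivision of rank $0$ is a surjective map $\phi\colon\Gamma\to B$ (with natural rank functions, $\rho(\hat 0)=0$) that is order-preserving, rank-increasing ($\rho(y)\le\rho(\phi(y))$), and such that for all $y\in\Gamma$, $x\in B$ with $\phi(y)\le x$: (1) there is $y'\ge y$ with $\phi(y')=x$, $\rho(y')=\rho(x)$; (2) $\sum_{y'\in\phi^{-1}(x),\,y\le y'}(-1)^{\rho(y')}=(-1)^{\rho(x)}$. For $x\ne\hat 0$ the poset $\Gamma_x$ is near-Eulerian, $\Gamma_{\hat 0}=\{\hat 0\}$, and each $\phi_x$ is again a strong formal subdivision of rank $0$. The mixed $cd$-index is $\Omega_\phi=\sum_{x\in B}\ell^\Phi_{\Gamma_x}(c',d')\cdot\Phi_{[x,\hat 1]}(c,d,e)\in R_\Omega$. *)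

theory Defs
  imports "HOL-Library.Poly_Mapping" HOL.Vector_Spaces
begin

section \<open>Graded posets\<close>

text \<open>
  A poset is given by its reflexive order relation \<open>r\<close>; its elements are \<open>Field r\<close>, and the
  induced order on a subset \<open>X\<close> is \<open>Restr r X\<close>.
\<close>

definition minimal_elements :: "'a rel \<Rightarrow> 'a set" where
  "minimal_elements r = {x \<in> Field r. \<forall>y. (y, x) \<in> r \<longrightarrow> y = x}"

definition maximal_elements :: "'a rel \<Rightarrow> 'a set" where
  "maximal_elements r = {x \<in> Field r. \<forall>y. (x, y) \<in> r \<longrightarrow> y = x}"

definition has_bot :: "'a rel \<Rightarrow> bool" where
  "has_bot r \<longleftrightarrow> (\<exists>!x. x \<in> minimal_elements r)"

definition has_top :: "'a rel \<Rightarrow> bool" where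
  "has_top r \<longleftrightarrow> (\<exists>!x. x \<in> maximal_elements r)"

definition bot_of :: "'a rel \<Rightarrow> 'a" where
  "bot_of r = (THE x. x \<in> minimal_elements r)"

definition top_of :: "'a rel \<Rightarrow> 'a" where
  "top_of r = (THE x. x \<in> maximal_elements r)"

definition max_chains :: "'a rel \<Rightarrow> 'a set set" where
  "max_chains r = {C \<in> Chains r. \<forall>D \<in> Chains r. C \<subseteq> D \<longrightarrow> C = D}"

text \<open>The length of a chain \<open>C\<close> is \<open>card C - 1\<close>.\<close>

definition has_rank :: "'a rel \<Rightarrow> nat \<Rightarrow> bool" where
  "has_rank r n \<longleftrightarrow> (\<forall>C \<in> max_chains r. card C = Suc n)"

definition poset_rank :: "'a rel \<Rightarrow> nat" where
  "poset_rank r = (THE n. has_rank r n)"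

definition graded_poset :: "'a rel \<Rightarrow> bool" where
  "graded_poset r \<longleftrightarrow>
     finite (Field r) \<and> Partial_order r \<and> has_bot r \<and> (\<exists>n. has_rank r n)"

definition interval :: "'a rel \<Rightarrow> 'a \<Rightarrow> 'a \<Rightarrow> 'a rel" where
  "interval r x y = Restr r {z. (x, z) \<in> r \<and> (z, y) \<in> r}"

definition rk :: "'a rel \<Rightarrow> 'a \<Rightarrow> nat" where
  "rk r x = poset_rank (interval r (bot_of r) x)"

definition covers :: "'a rel \<Rightarrow> 'a \<Rightarrow> 'a \<Rightarrow> bool" where
  "covers r x y \<longleftrightarrow> (x, y) \<in> r \<and> x \<noteq> y \<and>
     (\<forall>z. (x, z) \<in> r \<longrightarrow> (z, y) \<in> r \<longrightarrow> z = x \<or> z = y)"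

definition boundary :: "'a rel \<Rightarrow> 'a rel" where
  "boundary r = Restr r {x. \<exists>y \<in> Field r. (x, y) \<in> r \<and>
     Suc (rk r y) = poset_rank r \<and> card {z. covers r y z} = 1}"

definition eulerian :: "'a rel \<Rightarrow> bool" where
  "eulerian r \<longleftrightarrow> graded_poset r \<and> has_top r \<and>
     (\<forall>x y. (x, y) \<in> r \<longrightarrow> poset_rank (interval r x y) > 0 \<longrightarrow>
        card {z \<in> Field (interval r x y). even (rk r z)} =
        card {z \<in> Field (interval r x y). odd (rk r z)})"

definition lower_eulerian :: "'a rel \<Rightarrow> bool" where
  "lower_eulerian r \<longleftrightarrow> graded_poset r \<and> (\<forall>x y. (x, y) \<in> r \<longrightarrow> eulerian (interval r x y))"

text \<open>The new element of the semisuspension is \<open>None\<close>.\<close>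

definition semisuspension :: "'a rel \<Rightarrow> 'a option rel" where
  "semisuspension r = map_prod Some Some ` r \<union>
     (\<lambda>x. (Some x, None)) ` Field (boundary r) \<union> {(None, None)}"


section \<open>Free algebras and tensor products\<close>

text \<open>
  Vector spaces with a distinguished basis \<open>X\<close> are modelled by \<open>X \<Rightarrow>\<^sub>0 'k\<close>. With concatenation of
  lists as addition, \<open>'l list \<Rightarrow>\<^sub>0 'k\<close> with the convolution product of \<open>HOL-Library.Poly_Mapping\<close>
  is the free associative algebra on the letters \<open>'l\<close>.
\<close>

instantiation list :: (type) monoid_add
begin

definition zero_list :: "'a list" where "zero_list = []"

definition plus_list :: "'a list \<Rightarrow> 'a list \<Rightarrow> 'a list" where "plus_list = (@)"

instance by standard (simp_all add: zero_list_def plus_list_def)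

end

definition scale :: "'k::field \<Rightarrow> ('x \<Rightarrow>\<^sub>0 'k) \<Rightarrow> ('x \<Rightarrow>\<^sub>0 'k)" where
  "scale k p = Poly_Mapping.map ((*) k) p"

lemma scale_lookup [simp]: "Poly_Mapping.lookup (scale k p) x = k * Poly_Mapping.lookup p x"
  by (simp add: scale_def map.rep_eq when_def)

interpretation pm: vector_space "scale :: 'k::field \<Rightarrow> ('x \<Rightarrow>\<^sub>0 'k) \<Rightarrow> ('x \<Rightarrow>\<^sub>0 'k)"
  by unfold_locales (auto intro!: poly_mapping_eqI simp: lookup_add algebra_simps)

text \<open>The linear map with prescribed values on the basis:\<close>

definition lin_ext :: "('x \<Rightarrow> 'y \<Rightarrow>\<^sub>0 'k) \<Rightarrow> ('x \<Rightarrow>\<^sub>0 'k) \<Rightarrow> ('y \<Rightarrow>\<^sub>0 'k::field)" where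
  "lin_ext f p = (\<Sum>x \<in> Poly_Mapping.keys p. scale (Poly_Mapping.lookup p x) (f x))"

text \<open>The tensor product of the spaces with bases \<open>X\<close> and \<open>Y\<close> is the space with basis \<open>X \<times> Y\<close>.\<close>

definition tensor ::
  "('x \<Rightarrow>\<^sub>0 'k) \<Rightarrow> ('y \<Rightarrow>\<^sub>0 'k) \<Rightarrow> ('x \<times> 'y \<Rightarrow>\<^sub>0 'k::field)"  (infixr "\<otimes>\<^sub>K" 70) where
  "p \<otimes>\<^sub>K q =
     (\<Sum>x \<in> Poly_Mapping.keys p. \<Sum>y \<in> Poly_Mapping.keys q.
        Poly_Mapping.single (x, y) (Poly_Mapping.lookup p x * Poly_Mapping.lookup q y))"

definition tensor_space ::
  "('x \<Rightarrow>\<^sub>0 'k) set \<Rightarrow> ('y \<Rightarrow>\<^sub>0 'k) set \<Rightarrow> ('x \<times> 'y \<Rightarrow>\<^sub>0 'k::field) set" where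
  "tensor_space U V = pm.span {p \<otimes>\<^sub>K q | p q. p \<in> U \<and> q \<in> V}"

datatype ab = a_letter | b_letter

datatype cd = c_letter | d_letter

text \<open>The monomials of the quotient in which \<open>e\<close> annihilates every letter and itself:\<close>

datatype 'l eword = e_letter | word "'l list"

type_synonym 'k R_Psi = "ab list \<Rightarrow>\<^sub>0 'k"
type_synonym 'k R_Phi = "cd list \<Rightarrow>\<^sub>0 'k"
type_synonym 'k R_Psi_e = "ab eword \<Rightarrow>\<^sub>0 'k"
type_synonym 'k R_Phi_e = "cd eword \<Rightarrow>\<^sub>0 'k"

abbreviation letter :: "'l \<Rightarrow> ('l list \<Rightarrow>\<^sub>0 'k::field)" where
  "letter l \<equiv> Poly_Mapping.single [l] 1"

fun cd_letter_to_ab :: "cd \<Rightarrow> 'k::field R_Psi" where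
  "cd_letter_to_ab c_letter = letter a_letter + letter b_letter"
| "cd_letter_to_ab d_letter =
     letter a_letter * letter b_letter + letter b_letter * letter a_letter"

definition cd_to_ab :: "'k::field R_Phi \<Rightarrow> 'k R_Psi" where
  "cd_to_ab = lin_ext (\<lambda>w. prod_list (map cd_letter_to_ab w))"

definition add_e :: "('l list \<Rightarrow>\<^sub>0 'k) \<Rightarrow> ('l eword \<Rightarrow>\<^sub>0 'k::field)" where
  "add_e = lin_ext (\<lambda>w. Poly_Mapping.single (word w) 1)"

definition cde_to_abe :: "'k::field R_Phi_e \<Rightarrow> 'k R_Psi_e" where
  "cde_to_abe = lin_ext (\<lambda>w. case w of
     e_letter \<Rightarrow> Poly_Mapping.single e_letter 1
   | word v \<Rightarrow> add_e (cd_to_ab (Poly_Mapping.single v 1)))"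


section \<open>The cd-index, the local and the mixed cd-index\<close>

definition flag_f :: "'a rel \<Rightarrow> nat set \<Rightarrow> nat" where
  "flag_f r T = card {C \<in> Chains r. bot_of r \<notin> C \<and> rk r ` C = T}"

definition flag_h :: "'a rel \<Rightarrow> nat set \<Rightarrow> int" where
  "flag_h r S = (\<Sum>T \<in> Pow S. (- 1) ^ card (S - T) * int (flag_f r T))"

definition ab_index :: "'a rel \<Rightarrow> 'k::field_char_0 R_Psi" where
  "ab_index r = (\<Sum>S \<in> Pow {1..poset_rank r}.
     Poly_Mapping.single
       (map (\<lambda>i. if i \<in> S then b_letter else a_letter) [1..<Suc (poset_rank r)])
       (of_int (flag_h r S)))"

text \<open>For boundaries of Eulerian posets of positive rank:\<close>

definition cd_index :: "'a rel \<Rightarrow> 'k::field_char_0 R_Phi" where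
  "cd_index r = (THE p. cd_to_ab p = ab_index r)"

text \<open>For Eulerian posets:\<close>

definition cde_index :: "'a rel \<Rightarrow> 'k::field_char_0 R_Phi_e" where
  "cde_index r = (if poset_rank r = 0 then Poly_Mapping.single e_letter 1
                  else add_e (cd_index (boundary r)))"

text \<open>The elements \<open>\<Phi>(c, d, e)\<close>, where \<open>c = a + b\<close> and \<open>d = ab + ba\<close>:\<close>

definition Phi :: "'a rel \<Rightarrow> 'k::field_char_0 R_Psi_e" where
  "Phi r = cde_to_abe (cde_index r)"

text \<open>For near-Eulerian posets and singletons:\<close>

definition local_cd_index :: "'a rel \<Rightarrow> 'k::field_char_0 R_Phi" where
  "local_cd_index r = (if is_singleton (Field r) then 1
     else cd_index (semisuspension r) - cd_index (boundary r) * letter c_letter)"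

definition strong_formal_subdivision :: "'a rel \<Rightarrow> 'b rel \<Rightarrow> ('a \<Rightarrow> 'b) \<Rightarrow> bool" where
  "strong_formal_subdivision \<Gamma> B \<phi> \<longleftrightarrow>
     \<phi> ` Field \<Gamma> = Field B \<and>
     (\<forall>y y'. (y, y') \<in> \<Gamma> \<longrightarrow> (\<phi> y, \<phi> y') \<in> B) \<and>
     (\<forall>y \<in> Field \<Gamma>. rk \<Gamma> y \<le> rk B (\<phi> y)) \<and>
     (\<forall>y \<in> Field \<Gamma>. \<forall>x \<in> Field B. (\<phi> y, x) \<in> B \<longrightarrow>
        (\<exists>y'. (y, y') \<in> \<Gamma> \<and> \<phi> y' = x \<and> rk \<Gamma> y' = rk B x) \<and>
        (\<Sum>y' \<in> {y' \<in> Field \<Gamma>. \<phi> y' = x \<and> (y, y') \<in> \<Gamma>}. (- 1 :: int) ^ rk \<Gamma> y') =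
          (- 1) ^ rk B x)"

definition sub_over :: "('a \<Rightarrow> 'b) \<Rightarrow> 'a rel \<Rightarrow> 'b rel \<Rightarrow> 'b \<Rightarrow> 'a rel" where
  "sub_over \<phi> \<Gamma> B x = Restr \<Gamma> {y \<in> Field \<Gamma>. (\<phi> y, x) \<in> B}"

text \<open>
  \<open>R\<^sub>\<Phi>\<^sup>e\<close> is regarded as a subspace of \<open>R\<^sub>\<Psi>\<^sup>e\<close>, namely the range of \<open>cde_to_abe\<close>; the words in
  \<open>cd\<close> are the monomials in the primed letters \<open>c', d'\<close>.
\<close>

type_synonym 'k R_Omega_ambient = "cd list \<times> ab eword \<Rightarrow>\<^sub>0 'k"

definition R_Omega :: "'k::field R_Omega_ambient set" where
  "R_Omega = tensor_space UNIV (range cde_to_abe)"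

text \<open>The values of \<open>\<phi>\<close> outside \<open>Field \<Gamma>\<close> are irrelevant.\<close>

definition mixed_cd_index ::
  "('a \<Rightarrow> 'b) \<Rightarrow> 'a rel \<Rightarrow> 'b rel \<Rightarrow> 'k::field_char_0 R_Omega_ambient" where
  "mixed_cd_index \<phi> \<Gamma> B =
     (\<Sum>x \<in> Field B. local_cd_index (sub_over \<phi> \<Gamma> B x) \<otimes>\<^sub>K Phi (interval B x (top_of B)))"


section \<open>The coproduct and the coaction\<close>

fun coproduct_monomial :: "ab eword \<Rightarrow> (ab eword \<times> ab eword \<Rightarrow>\<^sub>0 'k::field)" where
  "coproduct_monomial e_letter = Poly_Mapping.single (e_letter, e_letter) 1"
| "coproduct_monomial (word w) =
     Poly_Mapping.single (e_letter, word w) 1 +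
     (\<Sum>i < length w. Poly_Mapping.single (word (take i w), word (drop (Suc i) w)) 1) +
     Poly_Mapping.single (word w, e_letter) 1"

definition coproduct :: "'k::field R_Psi_e \<Rightarrow> (ab eword \<times> ab eword \<Rightarrow>\<^sub>0 'k)" where
  "coproduct = lin_ext coproduct_monomial"

text \<open>\<open>w' \<cdot> (w\<^sub>1 \<otimes> w\<^sub>2) = (w' \<cdot> w\<^sub>1) \<otimes> w\<^sub>2\<close>\<close>

definition prime_act ::
  "cd list \<Rightarrow> (ab eword \<times> ab eword \<Rightarrow>\<^sub>0 'k::field) \<Rightarrow>
     ((cd list \<times> ab eword) \<times> ab eword \<Rightarrow>\<^sub>0 'k)" where
  "prime_act w' = lin_ext (\<lambda>(w\<^sub>1, w\<^sub>2). Poly_Mapping.single ((w', w\<^sub>1), w\<^sub>2) 1)"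

definition coaction ::
  "'k::field R_Omega_ambient \<Rightarrow> ((cd list \<times> ab eword) \<times> ab eword \<Rightarrow>\<^sub>0 'k)" where
  "coaction = lin_ext (\<lambda>(w', w). prime_act w' (coproduct (Poly_Mapping.single w 1)))"


section \<open>Well-definedness\<close>

text \<open>
  \<open>inj_cd_to_ab\<close> gives the uniqueness of cd-indices; \<open>coproduct_restricts\<close>,
  \<open>mixed_cd_index_in\<close> and \<open>coaction_in\<close> say that \<open>\<Delta>\<close> maps \<open>R\<^sub>\<Phi>\<^sup>e\<close> to \<open>R\<^sub>\<Phi>\<^sup>e \<otimes> R\<^sub>\<Phi>\<^sup>e\<close>, that
  \<open>\<Omega>\<^sub>\<phi> \<in> R\<^sub>\<Omega>\<close>, and that \<open>coaction\<close> maps \<open>R\<^sub>\<Omega>\<close> to \<open>R\<^sub>\<Omega> \<otimes> R\<^sub>\<Phi>\<^sup>e\<close>.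
\<close>

lemma lin_ext_superset:
  assumes "finite X" "Poly_Mapping.keys p \<subseteq> X"
  shows "lin_ext f p = (\<Sum>x\<in>X. scale (Poly_Mapping.lookup p x) (f x))"
  unfolding lin_ext_def
  by (rule sum.mono_neutral_left) (use assms in \<open>auto simp: in_keys_iff\<close>)

lemma lin_ext_add: "lin_ext f (p + q) = lin_ext f p + lin_ext f q"
proof -
  let ?X = "Poly_Mapping.keys p \<union> Poly_Mapping.keys q"
  have "lin_ext f (p + q) = (\<Sum>x\<in>?X. scale (Poly_Mapping.lookup (p+q) x) (f x))"
    by (rule lin_ext_superset) (use Poly_Mapping.keys_add[of p q] in auto)
  also have "\<dots> = (\<Sum>x\<in>?X. scale (Poly_Mapping.lookup p x) (f x)) + (\<Sum>x\<in>?X. scale (Poly_Mapping.lookup q x) (f x))"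
    by (simp add: lookup_add pm.scale_left_distrib sum.distrib)
  also have "(\<Sum>x\<in>?X. scale (Poly_Mapping.lookup p x) (f x)) = lin_ext f p"
    by (rule lin_ext_superset[symmetric]) auto
  also have "(\<Sum>x\<in>?X. scale (Poly_Mapping.lookup q x) (f x)) = lin_ext f q"
    by (rule lin_ext_superset[symmetric]) auto
  finally show ?thesis .
qed

lemma lin_ext_scale: "lin_ext f (scale k p) = scale k (lin_ext f p)"
proof -
  have "lin_ext f (scale k p) = (\<Sum>x\<in>Poly_Mapping.keys p. scale (Poly_Mapping.lookup (scale k p) x) (f x))"
    by (rule lin_ext_superset) (auto simp: in_keys_iff)
  then show ?thesis by (simp add: lin_ext_def pm.scale_sum_right)
qed

lemma lin_ext_single [simp]: "lin_ext f (Poly_Mapping.single x k) = scale k (f x)"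
  by (subst lin_ext_superset[of "{x}"]) auto

lemma lin_ext_zero [simp]: "lin_ext f 0 = 0" by (simp add: lin_ext_def)
lemma lin_ext_sum: "lin_ext f (sum g A) = (\<Sum>a\<in>A. lin_ext f (g a))"
  by (induction A rule: infinite_finite_induct) (auto simp: lin_ext_add)

lemma single_eq_scale: "Poly_Mapping.single x k = scale k (Poly_Mapping.single x 1)"
  by (rule poly_mapping_eqI) (auto simp: lookup_single when_def)

lemma scale_single: "scale k (Poly_Mapping.single x l) = Poly_Mapping.single x (k * l)"
  by (rule poly_mapping_eqI) (auto simp: lookup_single when_def)

lemma pm_expand: "p = (\<Sum>x\<in>Poly_Mapping.keys p. scale (Poly_Mapping.lookup p x) (Poly_Mapping.single x 1))"
  by (rule poly_mapping_eqI) (auto simp: lookup_sum lookup_single when_def in_keys_iff if_distrib cong: if_cong)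

lemma lin_ext_eqI:
  assumes "\<And>p q. F (p + q) = F p + F q" "\<And>k p. F (scale k p) = scale k (F p)"
    "\<And>x. F (Poly_Mapping.single x 1) = f x"
  shows "F p = lin_ext f p"
proof -
  have z: "F 0 = 0" using assms(2)[of 0 0] by simp
  have s: "F (sum g A) = (\<Sum>a\<in>A. F (g a))" for g :: "'x \<Rightarrow> _" and A
    by (induction A rule: infinite_finite_induct) (auto simp: assms(1) z)
  show ?thesis by (subst pm_expand) (simp add: s assms lin_ext_def)
qed

lemma tensor_lin: "p \<otimes>\<^sub>K q = lin_ext (\<lambda>x. lin_ext (\<lambda>y. Poly_Mapping.single (x,y) 1) q) p"
  by (simp add: tensor_def lin_ext_def pm.scale_sum_right scale_single del: pm.scale_scale)

lemma tensor_add_left: "(p + p') \<otimes>\<^sub>K q = p \<otimes>\<^sub>K q + p' \<otimes>\<^sub>K q"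
  by (simp add: tensor_lin lin_ext_add)
lemma lin_ext_fun_add: "lin_ext (\<lambda>x. f x + g x) p = lin_ext f p + lin_ext g p"
  by (simp add: lin_ext_def pm.scale_right_distrib sum.distrib)
lemma lin_ext_fun_scale: "lin_ext (\<lambda>x. scale k (f x)) p = scale k (lin_ext f p)"
  by (simp add: lin_ext_def pm.scale_sum_right mult.commute)
lemma tensor_add_right: "p \<otimes>\<^sub>K (q + q') = p \<otimes>\<^sub>K q + p \<otimes>\<^sub>K q'"
  by (simp add: tensor_lin lin_ext_add lin_ext_fun_add)
lemma tensor_scale_left: "scale k p \<otimes>\<^sub>K q = scale k (p \<otimes>\<^sub>K q)"
  by (simp add: tensor_lin lin_ext_scale)
lemma tensor_scale_right: "p \<otimes>\<^sub>K scale k q = scale k (p \<otimes>\<^sub>K q)"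
  by (simp add: tensor_lin lin_ext_scale lin_ext_fun_scale)
lemma tensor_single: "Poly_Mapping.single x k \<otimes>\<^sub>K Poly_Mapping.single y l = Poly_Mapping.single (x,y) (k*l)"
  by (simp add: tensor_lin) (metis (no_types) pm.scale_scale single_eq_scale)



lemma letter_single: "letter l * Poly_Mapping.single v k = Poly_Mapping.single (l # v) k"
  by (simp add: mult_single plus_list_def)

lemma times_scale: "p * scale k q = scale k (p * q)" for p q :: "'l list \<Rightarrow>\<^sub>0 'k::field"
proof -
  have c: "p * Poly_Mapping.single 0 k = Poly_Mapping.single 0 k * p" for p :: "'l list \<Rightarrow>\<^sub>0 'k"
  proof -
    have "p * Poly_Mapping.single 0 k = (\<Sum>x\<in>Poly_Mapping.keys p. scale (Poly_Mapping.lookup p x) (Poly_Mapping.single x 1) * Poly_Mapping.single 0 k)"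
      by (subst pm_expand) (simp add: sum_distrib_right)
    also have "\<dots> = (\<Sum>x\<in>Poly_Mapping.keys p. Poly_Mapping.single 0 k * scale (Poly_Mapping.lookup p x) (Poly_Mapping.single x 1))"
      by (rule sum.cong) (simp_all add: single_eq_scale[symmetric] mult_single mult.commute)
    also have "\<dots> = Poly_Mapping.single 0 k * p"
      by (subst (3) pm_expand) (simp add: sum_distrib_left)
    finally show ?thesis .
  qed
  show ?thesis unfolding scale_def mult_map_scale_conv_mult
    by (metis c mult.assoc)
qed

lemma letter_times: "letter l * p = lin_ext (\<lambda>v. Poly_Mapping.single (l # v) 1) p"
  by (rule lin_ext_eqI) (simp_all add: distrib_left times_scale letter_single)

lemma lookup_letter_times:
  "Poly_Mapping.lookup (letter l * p) w = (case w of [] \<Rightarrow> 0 | m # v \<Rightarrow> if m = l then Poly_Mapping.lookup p v else 0)"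
  by (auto simp: letter_times lin_ext_def lookup_sum lookup_single when_def in_keys_iff if_distrib
      split: list.split cong: if_cong)

definition cd_prod :: "cd list \<Rightarrow> 'k::field R_Psi" where
  "cd_prod w = prod_list (map cd_letter_to_ab w)"

lemma cd_to_ab_alt: "cd_to_ab = lin_ext cd_prod" 
  by (simp add: cd_to_ab_def cd_prod_def[abs_def])

definition tail_at :: "'l \<Rightarrow> ('l list \<Rightarrow>\<^sub>0 'k) \<Rightarrow> ('l list \<Rightarrow>\<^sub>0 'k::field)" where
  "tail_at l p = Poly_Mapping.map_key ((#) l) p"

lemma lookup_tail_at [simp]: "Poly_Mapping.lookup (tail_at l p) w = Poly_Mapping.lookup p (l # w)"
  by (simp add: tail_at_def map_key.rep_eq)

lemma cd_decomp:
  "p = Poly_Mapping.single [] (Poly_Mapping.lookup p []) + letter c_letter * tail_at c_letter p + letter d_letter * tail_at d_letter p"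
proof (rule poly_mapping_eqI, goal_cases)
  case (1 w)
  show ?case
    by (cases w) (auto simp: lookup_add lookup_single lookup_letter_times when_def intro: cd.exhaust)
qed

lemma cd_to_ab_letter: "cd_to_ab (letter x * p) = cd_letter_to_ab x * cd_to_ab p"
proof -
  have "cd_to_ab (letter x * p) = lin_ext (\<lambda>w. cd_prod (x # w)) p"
    by (rule lin_ext_eqI) (simp_all add: distrib_left times_scale letter_single cd_to_ab_alt lin_ext_add lin_ext_scale)
  moreover have "cd_letter_to_ab x * cd_to_ab p = lin_ext (\<lambda>w. cd_prod (x # w)) p"
    by (rule lin_ext_eqI) (simp_all add: distrib_left times_scale cd_to_ab_alt lin_ext_add lin_ext_scale cd_prod_def)
  ultimately show ?thesis by simp
qed

lemma cd_to_ab_single_Nil: "cd_to_ab (Poly_Mapping.single [] k) = Poly_Mapping.single [] k"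
  by (simp add: cd_to_ab_alt cd_prod_def zero_list_def flip: single_eq_scale single_one)

lemma cd_to_ab_eq_0:
  assumes "cd_to_ab p = 0" shows "p = 0"
proof -
  have "(\<forall>w\<in>Poly_Mapping.keys p. length w < n) \<Longrightarrow> cd_to_ab p = 0 \<Longrightarrow> p = 0" for n and p :: "'a R_Phi"
  proof (induction n arbitrary: p)
    case 0
    then show ?case by simp
  next
    case (Suc n)
    define P1 where "P1 = cd_to_ab (tail_at c_letter p)"
    define P2 where "P2 = cd_to_ab (tail_at d_letter p)"
    let ?a = "letter a_letter :: 'a R_Psi" and ?b = "letter b_letter :: 'a R_Psi"
    have eq: "Poly_Mapping.single [] (Poly_Mapping.lookup p []) + (?a + ?b) * P1 + (?a * ?b + ?b * ?a) * P2 = 0"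
    proof -
      have "cd_to_ab (x + y) = cd_to_ab x + cd_to_ab y" for x y :: "'a R_Phi"
        by (simp add: cd_to_ab_alt lin_ext_add)
      with Suc.prems(2) cd_decomp[of p] show ?thesis
        by (metis P1_def P2_def cd_letter_to_ab.simps cd_to_ab_letter cd_to_ab_single_Nil)
    qed
    then have eq: "Poly_Mapping.single [] (Poly_Mapping.lookup p []) + ?a * (P1 + ?b * P2) + ?b * (P1 + ?a * P2) = 0"
      by (simp add: algebra_simps)
    have k0: "Poly_Mapping.lookup p [] = 0"
      using arg_cong[OF eq, of "\<lambda>q. Poly_Mapping.lookup q []"]
      by (simp add: lookup_add lookup_letter_times)
    have A: "P1 + ?b * P2 = 0"
    proof (rule poly_mapping_eqI, goal_cases)
      case (1 w)
      show ?case using arg_cong[OF eq, of "\<lambda>q. Poly_Mapping.lookup q (a_letter # w)"]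
        by (simp add: lookup_add lookup_letter_times[of _ _ "_ # _"] lookup_single k0)
    qed
    have B: "P1 + ?a * P2 = 0"
    proof (rule poly_mapping_eqI, goal_cases)
      case (1 w)
      show ?case using arg_cong[OF eq, of "\<lambda>q. Poly_Mapping.lookup q (b_letter # w)"]
        by (simp add: lookup_add lookup_letter_times[of _ _ "_ # _"] lookup_single k0)
    qed
    have AB: "?a * P2 = ?b * P2" using A B by (metis add_left_cancel)
    have P2: "P2 = 0"
    proof (rule poly_mapping_eqI, goal_cases)
      case (1 w)
      show ?case using arg_cong[OF AB, of "\<lambda>q. Poly_Mapping.lookup q (a_letter # w)"]
        by (simp add: lookup_letter_times)
    qed
    have P1: "P1 = 0" using A P2 by simp
    have "tail_at c_letter p = 0" "tail_at d_letter p = 0"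
      using Suc.prems(1) P1 P2 by (force intro!: Suc.IH simp: P1_def P2_def in_keys_iff)+
    then show ?case by (subst cd_decomp) (simp add: k0)
  qed
  moreover have "\<exists>n. \<forall>w\<in>Poly_Mapping.keys p. length w < n"
    using finite_nat_set_iff_bounded[of "length ` Poly_Mapping.keys p"] by auto
  ultimately show ?thesis using assms by blast
qed

lemma inj_cd_to_ab: "inj cd_to_ab"
proof (rule injI)
  fix p q :: "'a R_Phi" assume "cd_to_ab p = cd_to_ab q"
  then have "cd_to_ab (p + scale (-1) q) = 0"
    by (simp only: cd_to_ab_alt lin_ext_add lin_ext_scale) simp
  then have "p + scale (-1) q = 0" by (rule cd_to_ab_eq_0)
  then show "p = q" by simp
qed

lemma add_e_cd_in: "add_e (cd_to_ab p) \<in> range cde_to_abe"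
proof -
  have "add_e (cd_to_ab p) = lin_ext (\<lambda>v. add_e (cd_prod v)) p"
    by (rule lin_ext_eqI) (simp_all add: add_e_def cd_to_ab_alt lin_ext_add lin_ext_scale)
  moreover have "cde_to_abe (add_e p) = lin_ext (\<lambda>v. add_e (cd_prod v)) p"
    by (rule lin_ext_eqI) (simp_all add: cde_to_abe_def add_e_def cd_to_ab_alt lin_ext_add lin_ext_scale)
  ultimately have "add_e (cd_to_ab p) = cde_to_abe (add_e p)" by simp
  then show ?thesis by blast
qed

lemma e_in: "Poly_Mapping.single e_letter 1 \<in> range cde_to_abe"
  by (rule range_eqI[of _ _ "Poly_Mapping.single e_letter 1"]) (simp add: cde_to_abe_def)

definition mid :: "ab list \<Rightarrow> (ab eword \<times> ab eword \<Rightarrow>\<^sub>0 'k::field)" where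
  "mid w = (\<Sum>i < length w. Poly_Mapping.single (word (take i w), word (drop (Suc i) w)) 1)"

definition prep :: "ab \<Rightarrow> (ab eword \<times> ab eword \<Rightarrow>\<^sub>0 'k) \<Rightarrow> (ab eword \<times> ab eword \<Rightarrow>\<^sub>0 'k::field)" where
  "prep x = lin_ext (\<lambda>(u, v). Poly_Mapping.single (case u of e_letter \<Rightarrow> e_letter | word s \<Rightarrow> word (x # s), v) 1)"

abbreviation "one_e \<equiv> Poly_Mapping.single (word []) 1"

lemma mid_Cons: "mid (x # v) = Poly_Mapping.single (word [], word v) 1 + prep x (mid v)"
  unfolding mid_def prep_def
  by (simp add: lin_ext_sum sum.lessThan_Suc_shift del: sum.lessThan_Suc)

lemma lin_mid: "lin_ext mid (letter x * p) = one_e \<otimes>\<^sub>K add_e p + prep x (lin_ext mid p)"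
proof -
  have "lin_ext mid (letter x * p) = lin_ext (\<lambda>v. mid (x # v)) p"
    by (rule lin_ext_eqI) (simp_all add: distrib_left times_scale letter_single lin_ext_add lin_ext_scale)
  moreover have "one_e \<otimes>\<^sub>K add_e p + prep x (lin_ext mid p) = lin_ext (\<lambda>v. mid (x # v)) p"
    by (rule lin_ext_eqI) (simp_all add: prep_def mid_Cons add_e_def lin_ext_add lin_ext_scale tensor_add_right tensor_scale_right tensor_single pm.scale_right_distrib)
  ultimately show ?thesis by simp
qed

lemma prep_tensor: "prep x (add_e p \<otimes>\<^sub>K q) = add_e (letter x * p) \<otimes>\<^sub>K q"
proof -
  have "prep x (add_e p \<otimes>\<^sub>K q) = lin_ext (\<lambda>v. Poly_Mapping.single (word (x # v)) 1 \<otimes>\<^sub>K q) p"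
  proof (rule lin_ext_eqI, goal_cases)
    case (3 v)
    have "prep x (Poly_Mapping.single (word v) 1 \<otimes>\<^sub>K q) = lin_ext (\<lambda>y. Poly_Mapping.single (word (x#v), y) 1) q" for q :: "ab eword \<Rightarrow>\<^sub>0 'a"
      by (rule lin_ext_eqI) (simp_all add: prep_def lin_ext_add lin_ext_scale tensor_add_right tensor_scale_right tensor_single)
    then show ?case by (simp add: add_e_def tensor_lin)
  qed (simp_all add: prep_def add_e_def lin_ext_add lin_ext_scale tensor_add_left tensor_scale_left)
  moreover have "add_e (letter x * p) \<otimes>\<^sub>K q = lin_ext (\<lambda>v. Poly_Mapping.single (word (x # v)) 1 \<otimes>\<^sub>K q) p"
    by (rule lin_ext_eqI) (simp_all add: distrib_left times_scale letter_single add_e_def lin_ext_add lin_ext_scale tensor_add_left tensor_scale_left)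
  ultimately show ?thesis by simp
qed

definition mid_space :: "(ab eword \<times> ab eword \<Rightarrow>\<^sub>0 'k::field) set" where
  "mid_space = pm.span {add_e (cd_to_ab p) \<otimes>\<^sub>K add_e (cd_to_ab q) | p q. True}"

lemma mid_space_prep:
  assumes "T \<in> mid_space"
  shows "prep a_letter T + prep b_letter T \<in> mid_space" (is ?A)
    "prep a_letter (prep b_letter T) + prep b_letter (prep a_letter T) \<in> mid_space" (is ?B)
proof -
  have "?A \<and> ?B"
    using assms unfolding mid_space_def
  proof (induction rule: pm.span_induct_alt)
    case base
    then show ?case by (simp add: prep_def pm.span_zero)
  next
    case (step k t U)
    then obtain p q where t: "t = add_e (cd_to_ab p) \<otimes>\<^sub>K add_e (cd_to_ab q)" by auto
    let ?S = "pm.span {add_e (cd_to_ab p) \<otimes>\<^sub>K add_e (cd_to_ab q) | p q :: 'a R_Phi. True}"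
    have 1: "prep a_letter t + prep b_letter t \<in> ?S"
    proof -
      have "prep a_letter t + prep b_letter t = add_e (cd_to_ab (letter c_letter * p)) \<otimes>\<^sub>K add_e (cd_to_ab q)"
        unfolding t prep_tensor cd_to_ab_letter cd_letter_to_ab.simps
        by (simp only: distrib_right add_e_def lin_ext_add tensor_add_left)
      then show ?thesis by (auto intro: pm.span_base)
    qed
    have 2: "prep a_letter (prep b_letter t) + prep b_letter (prep a_letter t) \<in> ?S"
    proof -
      have "prep a_letter (prep b_letter t) + prep b_letter (prep a_letter t) =
          add_e (cd_to_ab (letter d_letter * p)) \<otimes>\<^sub>K add_e (cd_to_ab q)"
        unfolding t prep_tensor cd_to_ab_letter cd_letter_to_ab.simps
        by (simp only: distrib_right add_e_def lin_ext_add tensor_add_left mult.assoc)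
      then show ?thesis by (auto intro: pm.span_base)
    qed
    have l: "prep x (scale k t + U) = scale k (prep x t) + prep x U" for x k t and U :: "ab eword \<times> ab eword \<Rightarrow>\<^sub>0 'a"
      by (simp add: prep_def lin_ext_add lin_ext_scale)
    have "prep a_letter (scale k t + U) + prep b_letter (scale k t + U) =
        scale k (prep a_letter t + prep b_letter t) + (prep a_letter U + prep b_letter U)"
      by (simp add: l pm.scale_right_distrib)
    moreover have "prep a_letter (prep b_letter (scale k t + U)) + prep b_letter (prep a_letter (scale k t + U)) =
        scale k (prep a_letter (prep b_letter t) + prep b_letter (prep a_letter t)) +
        (prep a_letter (prep b_letter U) + prep b_letter (prep a_letter U))"
      by (simp add: l pm.scale_right_distrib)
    ultimately show ?case
      using 1 2 step by (metis (no_types, lifting) pm.span_add pm.span_scale)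
  qed
  then show ?A ?B by blast+
qed

lemma one_e_add: "one_e = add_e (cd_to_ab (Poly_Mapping.single [] 1))"
  by (simp add: cd_to_ab_single_Nil add_e_def)

lemma mid_space_base: "add_e (cd_to_ab p) \<otimes>\<^sub>K add_e (cd_to_ab q) \<in> mid_space"
  unfolding mid_space_def by (rule pm.span_base) blast

lemma mid_space_add: "A \<in> mid_space \<Longrightarrow> B \<in> mid_space \<Longrightarrow> A + B \<in> mid_space"
  unfolding mid_space_def by (rule pm.span_add)

lemma mid_in: "lin_ext mid (cd_prod w) \<in> mid_space"
proof (induction w)
  case Nil
  show ?case by (simp add: cd_prod_def mid_def zero_list_def mid_space_def pm.span_zero flip: single_one)
next
  case (Cons x w)
  define W :: "'a R_Psi" where "W = cd_prod w"
  have W: "W = cd_to_ab (Poly_Mapping.single w 1)" by (simp add: W_def cd_to_ab_alt)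
  have 1: "one_e \<otimes>\<^sub>K add_e W \<in> mid_space" unfolding one_e_add W by (rule mid_space_base)
  let ?M = "lin_ext mid W"
  have M: "?M \<in> mid_space" using Cons by (simp add: W_def)
  have prep_add: "prep l (A + B) = prep l A + prep l B" for l and A B :: "ab eword \<times> ab eword \<Rightarrow>\<^sub>0 'a"
    by (simp add: prep_def lin_ext_add)
  have oneA: "one_e = add_e (Poly_Mapping.single [] 1)" by (simp add: add_e_def)
  have one: "letter l * Poly_Mapping.single [] 1 = letter l" for l by (simp add: letter_single)
  show ?case
  proof (cases x)
    case c_letter
    have "lin_ext mid (cd_prod (x # w)) = one_e \<otimes>\<^sub>K add_e W + one_e \<otimes>\<^sub>K add_e W + (prep a_letter ?M + prep b_letter ?M)"
      by (simp add: c_letter cd_prod_def distrib_right lin_ext_add lin_mid flip: W_def[unfolded cd_prod_def])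
    then show ?thesis using 1 mid_space_prep(1)[OF M] by (auto intro!: mid_space_add)
  next
    case d_letter
    have c1: "letter a_letter + letter b_letter = (cd_to_ab (letter c_letter) :: 'a R_Psi)"
      by (simp add: cd_to_ab_alt cd_prod_def)
    have c2: "letter a_letter * W + letter b_letter * W = cd_to_ab (letter c_letter * Poly_Mapping.single w 1)"
      by (simp only: cd_to_ab_letter W cd_letter_to_ab.simps distrib_right)
    have "lin_ext mid (cd_prod (x # w)) =
       one_e \<otimes>\<^sub>K (add_e (letter b_letter * W) + add_e (letter a_letter * W)) +
       (prep a_letter (one_e \<otimes>\<^sub>K add_e W) + prep b_letter (one_e \<otimes>\<^sub>K add_e W)) +
       (prep a_letter (prep b_letter ?M) + prep b_letter (prep a_letter ?M))"
      by (simp add: d_letter cd_prod_def distrib_right lin_ext_add lin_mid mult.assoc prep_add tensor_add_right flip: W_def[unfolded cd_prod_def])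
    also have "add_e (letter b_letter * W) + add_e (letter a_letter * W) = add_e (cd_to_ab (letter c_letter * Poly_Mapping.single w 1))"
      unfolding c2[symmetric] by (simp add: add_e_def lin_ext_add add.commute)
    also have "prep a_letter (one_e \<otimes>\<^sub>K add_e W) + prep b_letter (one_e \<otimes>\<^sub>K add_e W) = add_e (cd_to_ab (letter c_letter)) \<otimes>\<^sub>K add_e W"
      unfolding oneA prep_tensor one c1[symmetric] tensor_add_left[symmetric] by (simp add: add_e_def lin_ext_add)
    finally show ?thesis
      using mid_space_prep(2)[OF M] mid_space_base[of "letter c_letter"] mid_space_base[of "Poly_Mapping.single [] 1"]
      unfolding W one_e_add by (auto intro!: mid_space_add)
  qed
qed

theorem coproduct_restricts:
  assumes "p \<in> range cde_to_abe"
  shows "coproduct p \<in> tensor_space (range cde_to_abe) (range cde_to_abe)"  (is "_ \<in> ?S")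
proof -
  have e: "coproduct (Poly_Mapping.single e_letter 1) \<in> ?S"
    unfolding tensor_space_def coproduct_def using e_in
    by (auto intro!: pm.span_base exI[of _ "Poly_Mapping.single e_letter 1"] simp: tensor_single)
  have sub: "mid_space \<subseteq> ?S"
    unfolding tensor_space_def mid_space_def by (rule pm.span_mono) (use add_e_cd_in in blast)
  have w: "coproduct (add_e (cd_prod w)) \<in> ?S" for w
  proof -
    have "coproduct (add_e P) = Poly_Mapping.single e_letter 1 \<otimes>\<^sub>K add_e P + lin_ext mid P + add_e P \<otimes>\<^sub>K Poly_Mapping.single e_letter 1" for P :: "'a R_Psi"
    proof -
      have "coproduct (add_e P) = lin_ext (\<lambda>v. coproduct_monomial (word v)) P"
        by (rule lin_ext_eqI) (simp_all add: coproduct_def add_e_def lin_ext_add lin_ext_scale)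
      moreover have "Poly_Mapping.single e_letter 1 \<otimes>\<^sub>K add_e P + lin_ext mid P + add_e P \<otimes>\<^sub>K Poly_Mapping.single e_letter 1 = lin_ext (\<lambda>v. coproduct_monomial (word v)) P"
        by (rule lin_ext_eqI) (simp_all add: add_e_def lin_ext_add lin_ext_scale tensor_add_left tensor_add_right tensor_scale_left tensor_scale_right tensor_single mid_def pm.scale_right_distrib)
      ultimately show ?thesis by simp
    qed
    moreover have "lin_ext mid (cd_prod w) \<in> ?S" using mid_in sub by blast
    moreover have "cd_prod w = (cd_to_ab (Poly_Mapping.single w 1) :: 'a R_Psi)" by (simp add: cd_to_ab_alt)
    then have "add_e (cd_prod w) \<in> range (cde_to_abe :: 'a R_Phi_e \<Rightarrow> _)" by (simp add: add_e_cd_in)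
    then have "Poly_Mapping.single e_letter 1 \<otimes>\<^sub>K add_e (cd_prod w) \<in> ?S"
      "add_e (cd_prod w) \<otimes>\<^sub>K Poly_Mapping.single e_letter 1 \<in> ?S"
      unfolding tensor_space_def using e_in by (blast intro: pm.span_base)+
    ultimately show ?thesis by (simp add: tensor_space_def pm.span_add)
  qed
  obtain q where p: "p = cde_to_abe q" using assms by blast
  have "coproduct (cde_to_abe q) = lin_ext (\<lambda>x. coproduct (cde_to_abe (Poly_Mapping.single x 1))) q"
    by (rule lin_ext_eqI) (simp_all add: coproduct_def cde_to_abe_def lin_ext_add lin_ext_scale)
  moreover have "(cde_to_abe (Poly_Mapping.single x 1) :: 'a R_Psi_e) =
      (case x of e_letter \<Rightarrow> Poly_Mapping.single e_letter 1 | word v \<Rightarrow> add_e (cd_prod v))" for x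
    by (simp add: cde_to_abe_def cd_to_ab_alt split: eword.split)
  then have "coproduct (cde_to_abe (Poly_Mapping.single x 1)) \<in> ?S" for x
    by (cases x) (simp_all add: e w)
  ultimately show ?thesis
    unfolding p lin_ext_def tensor_space_def by (auto intro!: pm.span_sum pm.span_scale)
qed


lemma Phi_in: "Phi r \<in> range cde_to_abe"
  by (simp add: Phi_def)

lemma mixed_cd_index_in: "mixed_cd_index \<phi> \<Gamma> B \<in> R_Omega"
  unfolding mixed_cd_index_def R_Omega_def tensor_space_def
  by (rule pm.span_sum, rule pm.span_base) (use Phi_in in blast)

lemma prime_act_tensor: "prime_act w' (p \<otimes>\<^sub>K q) = (Poly_Mapping.single w' 1 \<otimes>\<^sub>K p) \<otimes>\<^sub>K q"
proof -
  have 1: "prime_act w' (Poly_Mapping.single x 1 \<otimes>\<^sub>K q) = (Poly_Mapping.single w' 1 \<otimes>\<^sub>K Poly_Mapping.single x 1) \<otimes>\<^sub>K q" (is "?L q = ?R q") for x q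
  proof -
    have "?L q = lin_ext (\<lambda>y. Poly_Mapping.single ((w', x), y) 1) q"
      by (rule lin_ext_eqI) (simp_all add: prime_act_def lin_ext_add lin_ext_scale tensor_add_right tensor_scale_right tensor_single)
    moreover have "?R q = lin_ext (\<lambda>y. Poly_Mapping.single ((w', x), y) 1) q"
      by (rule lin_ext_eqI) (simp_all add: tensor_add_right tensor_scale_right tensor_single)
    ultimately show ?thesis by simp
  qed
  have "prime_act w' (p \<otimes>\<^sub>K q) = lin_ext (\<lambda>x. (Poly_Mapping.single w' 1 \<otimes>\<^sub>K Poly_Mapping.single x 1) \<otimes>\<^sub>K q) p"
    by (rule lin_ext_eqI) (simp_all only: 1, simp_all add: prime_act_def lin_ext_add lin_ext_scale tensor_add_left tensor_scale_left)
  moreover have "(Poly_Mapping.single w' 1 \<otimes>\<^sub>K p) \<otimes>\<^sub>K q = lin_ext (\<lambda>x. (Poly_Mapping.single w' 1 \<otimes>\<^sub>K Poly_Mapping.single x 1) \<otimes>\<^sub>K q) p"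
    by (rule lin_ext_eqI) (simp_all add: tensor_add_left tensor_scale_left tensor_add_right tensor_scale_right)
  ultimately show ?thesis by simp
qed

lemma coaction_tensor_single: "coaction (Poly_Mapping.single w' 1 \<otimes>\<^sub>K p) = prime_act w' (coproduct p)"
proof -
  have "coaction (Poly_Mapping.single w' 1 \<otimes>\<^sub>K p) = lin_ext (\<lambda>w. prime_act w' (coproduct (Poly_Mapping.single w 1))) p"
    by (rule lin_ext_eqI) (simp_all add: coaction_def lin_ext_add lin_ext_scale tensor_add_right tensor_scale_right tensor_single)
  moreover have "prime_act w' (coproduct p) = lin_ext (\<lambda>w. prime_act w' (coproduct (Poly_Mapping.single w 1))) p"
    by (rule lin_ext_eqI) (simp_all add: prime_act_def coproduct_def lin_ext_add lin_ext_scale)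
  ultimately show ?thesis by simp
qed

lemma coaction_in:
  assumes "p \<in> R_Omega"
  shows "coaction p \<in> tensor_space R_Omega (range cde_to_abe)"
proof -
  let ?T = "tensor_space R_Omega (range cde_to_abe) :: ((cd list \<times> ab eword) \<times> ab eword \<Rightarrow>\<^sub>0 'a) set"
  have a: "prime_act w' t \<in> ?T" if "t \<in> tensor_space (range cde_to_abe) (range cde_to_abe)" for w' t
    using that unfolding tensor_space_def[of "range cde_to_abe"]
  proof (induction rule: pm.span_induct_alt)
    case base
    show ?case by (simp add: prime_act_def tensor_space_def pm.span_zero)
  next
    case (step k t U)
    then obtain q r where t: "t = q \<otimes>\<^sub>K r" "q \<in> range cde_to_abe" "r \<in> range cde_to_abe" by auto
    have "Poly_Mapping.single w' 1 \<otimes>\<^sub>K q \<in> R_Omega"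
      unfolding R_Omega_def tensor_space_def using t by (blast intro: pm.span_base)
    then have "prime_act w' t \<in> ?T"
      unfolding t prime_act_tensor tensor_space_def using t by (blast intro: pm.span_base)
    then show ?case using step(2)
      by (simp add: prime_act_def lin_ext_add lin_ext_scale tensor_space_def pm.span_add pm.span_scale)
  qed
  have b: "coaction (q' \<otimes>\<^sub>K q) \<in> ?T" if "q \<in> range cde_to_abe" for q' q
  proof -
    have "coaction (q' \<otimes>\<^sub>K q) = lin_ext (\<lambda>w'. prime_act w' (coproduct q)) q'"
      by (rule lin_ext_eqI)
        (simp_all only: coaction_tensor_single, simp_all add: coaction_def lin_ext_add lin_ext_scale tensor_add_left tensor_scale_left)
    moreover have "prime_act w' (coproduct q) \<in> ?T" for w'
      using that by (intro a coproduct_restricts)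
    ultimately show ?thesis
      unfolding lin_ext_def tensor_space_def by (auto intro!: pm.span_sum pm.span_scale)
  qed
  have "p \<in> pm.span {p \<otimes>\<^sub>K q | p q. p \<in> UNIV \<and> q \<in> range cde_to_abe}"
    using assms unfolding R_Omega_def tensor_space_def .
  then show ?thesis
  proof (induction rule: pm.span_induct_alt)
    case base
    show ?case by (simp add: coaction_def tensor_space_def pm.span_zero)
  next
    case (step k t U)
    then have "coaction t \<in> ?T" using b by auto
    then show ?case using step(2)
      by (simp add: coaction_def lin_ext_add lin_ext_scale tensor_space_def pm.span_add pm.span_scale)
  qed
qed

end

theory Submission
  imports Defs
begin

text \<open>
  The coaction only affects the factors \<open>\<Phi>[x, 1]\<close>, and \<open>\<Gamma>\<close> enters both sides through the same
  posets \<open>\<Gamma>\<^sub>x\<close>, so everything reduces to \<open>\<Delta>(\<Phi>[x, y]) = (\<Sum>z. \<Phi>[x, z] \<otimes> \<Phi>[z, y])\<close> for Eulerian \<open>B\<close>.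

  Writing \<open>t = a - b\<close>, the ab-index of the boundary of \<open>[x, y]\<close> satisfies, by splitting off the least
  element of a chain,
  \<open>\<Psi>(x, y) = t ^ (\<rho>(x, y) - 1) + (\<Sum>x < z < y. t ^ (\<rho>(x, z) - 1) b \<Psi>(z, y))\<close>.
  The middle part of \<open>\<Delta>\<close> is a derivation that vanishes on \<open>t\<close> and maps \<open>b\<close> to \<open>1 \<otimes> 1\<close>, so the coproduct
  formula follows by induction, for every graded poset.

  It remains to see that the cd-index exists. Let \<open>v = 2 (\<zeta> + 1)\<^sup>-\<^sup>1 (\<zeta> - 1)\<close> be the Cayley
  transform of the zeta function. In an Eulerian poset \<open>\<zeta>\<^sup>-\<^sup>1\<close> is \<open>\<zeta>\<close> twisted by the sign of the
  rank, which makes \<open>v\<close> vanish on intervals of even rank. Putting \<open>V = v t ^ (\<rho> - 1)\<close>, one has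
  \<open>\<Psi> = V + V c \<Psi> / 2\<close>, and only even powers of \<open>t\<close> occur in \<open>V\<close>; these are powers of
  \<open>t ^ 2 = c ^ 2 - 2 d\<close>.
\<close>

section \<open>Bounded graded posets\<close>

lemma Field_Restr_refl: "refl_on (Field r) r \<Longrightarrow> Field (Restr r X) = X \<inter> Field r"
  by (auto simp: Field_def refl_on_def)

lemma chain_maximal_extension:
  assumes "finite X" "C \<in> Chains r" "C \<subseteq> X"
  obtains D where "D \<in> Chains r" "D \<subseteq> X" "C \<subseteq> D" "\<And>E. E \<in> Chains r \<Longrightarrow> E \<subseteq> X \<Longrightarrow> D \<subseteq> E \<Longrightarrow> E = D"
proof -
  define A where "A = {D \<in> Chains r. D \<subseteq> X \<and> C \<subseteq> D}"
  have "finite A" unfolding A_def by (rule finite_subset[of _ "Pow X"]) (use assms(1) in auto)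
  moreover have "C \<in> A" using assms by (simp add: A_def)
  ultimately obtain D where D: "D \<in> A" "\<And>E. E \<in> A \<Longrightarrow> D \<subseteq> E \<Longrightarrow> D = E"
    using finite_has_maximal2[of A C] by auto
  show thesis
  proof (rule that[of D])
    show "D \<in> Chains r" "D \<subseteq> X" "C \<subseteq> D" using D(1) by (simp_all add: A_def)
    show "E = D" if "E \<in> Chains r" "E \<subseteq> X" "D \<subseteq> E" for E
      using D(1) D(2)[of E] that by (auto simp: A_def)
  qed
qed

text \<open>Bottom and top are parameters with explicit bounds: a unique minimal element, as in
  \<open>has_bot\<close>, is a least element only by finiteness. \<open>eulerian_bounded\<close>
  makes that passage.\<close>

locale bounded_graded_poset =
  fixes r :: "'a rel" and bt tp :: 'a and n :: nat
  assumes fin: "finite (Field r)" and po: "Partial_order r"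
    and bt_le: "x \<in> Field r \<Longrightarrow> (bt, x) \<in> r"
    and le_tp: "x \<in> Field r \<Longrightarrow> (x, tp) \<in> r"
    and graded: "has_rank r n"
begin

abbreviation le (infix "\<sqsubseteq>" 50) where "x \<sqsubseteq> y \<equiv> (x, y) \<in> r"
abbreviation less (infix "\<sqsubset>" 50) where "x \<sqsubset> y \<equiv> x \<sqsubseteq> y \<and> x \<noteq> y"

lemma le_refl [simp]: "x \<in> Field r \<Longrightarrow> x \<sqsubseteq> x"
  using po by (auto simp: order_on_defs refl_on_def)
lemma le_trans [trans]: "x \<sqsubseteq> y \<Longrightarrow> y \<sqsubseteq> z \<Longrightarrow> x \<sqsubseteq> z"
  using po by (auto simp: order_on_defs dest: transD)
lemma le_antisym: "x \<sqsubseteq> y \<Longrightarrow> y \<sqsubseteq> x \<Longrightarrow> x = y"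
  using po by (auto simp: order_on_defs dest: antisymD)
lemma le_in: "x \<sqsubseteq> y \<Longrightarrow> x \<in> Field r" "x \<sqsubseteq> y \<Longrightarrow> y \<in> Field r"
  by (auto simp: Field_def)

section \<open>Intervals, their maximal chains, and additivity of the rank\<close>

definition icc :: "'a \<Rightarrow> 'a \<Rightarrow> 'a set" where "icc x y = {z. x \<sqsubseteq> z \<and> z \<sqsubseteq> y}"
definition ico :: "'a \<Rightarrow> 'a \<Rightarrow> 'a set" where "ico x y = {z. x \<sqsubseteq> z \<and> z \<sqsubset> y}"
definition ioo :: "'a \<Rightarrow> 'a \<Rightarrow> 'a set" where "ioo x y = {z. x \<sqsubset> z \<and> z \<sqsubset> y}"

lemma finite_icc [simp]: "finite (icc x y)" and finite_ico [simp]: "finite (ico x y)"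
  and finite_ioo [simp]: "finite (ioo x y)"
  by (rule finite_subset[OF _ fin]; auto simp: icc_def ico_def ioo_def Field_def)+

lemma interval_icc: "interval r x y = Restr r (icc x y)"
  by (simp add: interval_def icc_def)

lemma Field_Restr: "Field (Restr r X) = X \<inter> Field r"
  using po by (intro Field_Restr_refl) (auto simp: order_on_defs)

lemma Field_interval [simp]: "Field (interval r x y) = icc x y"
  by (auto simp: interval_icc Field_Restr icc_def dest: le_in)

lemma icc_whole: "icc bt tp = Field r"
  by (auto simp: icc_def bt_le le_tp dest: le_in)

text \<open>Maximality is put elementwise, the form that is easy to check when chains are
  concatenated; \<open>max_chains_Restr\<close> identifies it with maximality under
  inclusion.\<close>

definition mchains :: "'a set \<Rightarrow> 'a set set" where
  "mchains X = {C \<in> Chains r. C \<subseteq> X \<and> (\<forall>w\<in>X. (\<forall>c\<in>C. w \<sqsubseteq> c \<or> c \<sqsubseteq> w) \<longrightarrow> w \<in> C)}"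

lemma ChainsI: "(\<And>x y. x \<in> C \<Longrightarrow> y \<in> C \<Longrightarrow> x \<sqsubseteq> y \<or> y \<sqsubseteq> x) \<Longrightarrow> C \<in> Chains r"
  by (auto simp: Chains_def)

lemma ChainsD: "C \<in> Chains r \<Longrightarrow> x \<in> C \<Longrightarrow> y \<in> C \<Longrightarrow> x \<sqsubseteq> y \<or> y \<sqsubseteq> x"
  by (auto simp: Chains_def)

lemma Chains_Restr: "Chains (Restr r X) = {C \<in> Chains r. C \<subseteq> X}"
  by (auto simp: Chains_def)

lemma mchainsI:
  assumes "X \<subseteq> Field r" "C \<in> Chains r" "C \<subseteq> X"
    "\<And>D. D \<in> Chains r \<Longrightarrow> D \<subseteq> X \<Longrightarrow> C \<subseteq> D \<Longrightarrow> D = C"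
  shows "C \<in> mchains X"
proof -
  have "w \<in> C" if w: "w \<in> X" "\<forall>c\<in>C. w \<sqsubseteq> c \<or> c \<sqsubseteq> w" for w
  proof -
    have "insert w C \<in> Chains r"
      using assms(1,2) w by (intro ChainsI) (auto dest: ChainsD)
    then show ?thesis using assms(3) assms(4)[of "insert w C"] w by blast
  qed
  then show ?thesis using assms by (auto simp: mchains_def)
qed

lemma max_chains_Restr:
  assumes "X \<subseteq> Field r"
  shows "max_chains (Restr r X) = mchains X"
proof
  show "max_chains (Restr r X) \<subseteq> mchains X"
    using assms by (auto simp: max_chains_def Chains_Restr intro!: mchainsI)
  show "mchains X \<subseteq> max_chains (Restr r X)"
    by (auto simp: max_chains_def Chains_Restr mchains_def) (meson ChainsD subset_iff)
qed

lemma mchains_nonempty: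
  assumes "X \<subseteq> Field r"
  obtains C where "C \<in> mchains X"
proof -
  have "finite X" using assms fin finite_subset by blast
  then obtain C where "C \<in> Chains r" "C \<subseteq> X" "\<And>E. E \<in> Chains r \<Longrightarrow> E \<subseteq> X \<Longrightarrow> C \<subseteq> E \<Longrightarrow> E = C"
    by (rule chain_maximal_extension[of X "{}" r]) (auto simp: Chains_def)
  then show thesis using assms by (intro that[of C] mchainsI) auto
qed

lemma poset_rank_eqI:
  assumes "X \<subseteq> Field r" "\<And>C. C \<in> mchains X \<Longrightarrow> card C = Suc k"
  shows "poset_rank (Restr r X) = k"
  unfolding poset_rank_def has_rank_def max_chains_Restr[OF assms(1)]
  by (rule the_equality) (use assms(2) mchains_nonempty[OF assms(1)] in \<open>fastforce\<close>)+

lemma icc_subset: "icc x y \<subseteq> Field r"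
  by (auto simp: icc_def dest: le_in)

lemma mchains_icc_ends:
  assumes "x \<sqsubseteq> y" "C \<in> mchains (icc x y)"
  shows "x \<in> C" "y \<in> C"
proof -
  have sub: "C \<subseteq> icc x y"
    and mem: "\<And>w. w \<in> icc x y \<Longrightarrow> (\<And>c. c \<in> C \<Longrightarrow> w \<sqsubseteq> c \<or> c \<sqsubseteq> w) \<Longrightarrow> w \<in> C"
    using assms(2) by (auto simp: mchains_def)
  show "x \<in> C" using sub assms(1) le_in[OF assms(1)]
    by (intro mem) (auto simp: icc_def)
  show "y \<in> C" using sub assms(1) le_in[OF assms(1)]
    by (intro mem) (auto simp: icc_def)
qed

text \<open>Both chains contain w. An element comparable to the whole union is therefore comparable
  to w, so it lies in one of the two intervals and maximality there applies. The chains meet only in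
  w, which accounts for the 1.\<close>

lemma mchains_concat:
  assumes "x \<sqsubseteq> w" "w \<sqsubseteq> y" "C \<in> mchains (icc x w)" "D \<in> mchains (icc w y)"
  shows "C \<union> D \<in> mchains (icc x y)" "card (C \<union> D) + 1 = card C + card D"
proof -
  have C: "C \<in> Chains r" "C \<subseteq> icc x w" and D: "D \<in> Chains r" "D \<subseteq> icc w y"
    using assms by (auto simp: mchains_def)
  have wC: "w \<in> C" and wD: "w \<in> D" using assms mchains_icc_ends by blast+
  have CD: "c \<sqsubseteq> d" if "c \<in> C" "d \<in> D" for c d
    using C D that by (auto simp: icc_def intro: le_trans)
  have "C \<union> D \<in> Chains r"
    using C D CD by (intro ChainsI) (auto dest: ChainsD)
  moreover have "C \<union> D \<subseteq> icc x y"
    using C D assms(1,2) by (auto simp: icc_def subset_iff intro: le_trans)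
  moreover have "v \<in> C \<union> D" if v: "v \<in> icc x y" "\<forall>c\<in>C\<union>D. v \<sqsubseteq> c \<or> c \<sqsubseteq> v" for v
  proof (cases "v \<sqsubseteq> w")
    case True
    then show ?thesis using v assms(3) by (auto simp: icc_def mchains_def)
  next
    case False
    then have "w \<sqsubseteq> v" using v(2) wC by auto
    then show ?thesis using v assms(4) by (auto simp: icc_def mchains_def)
  qed
  ultimately show "C \<union> D \<in> mchains (icc x y)" by (auto simp: mchains_def)
  have fC: "finite C" "finite D" using C D finite_subset finite_icc by blast+
  have "C \<inter> D = {w}"
    using C D wC wD by (auto simp: icc_def subset_iff intro: le_antisym)
  then show "card (C \<union> D) + 1 = card C + card D"
    using card_Un_Int[OF fC] by simp
qed

definition len :: "'a \<Rightarrow> 'a \<Rightarrow> nat" where "len x y = poset_rank (interval r x y)"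

text \<open>Fixed maximal chains below x and above y complete C to a maximal chain of the whole
  poset, whose size is known. Hence the size of C does not depend on C, and the \<open>THE\<close>
  in \<open>len\<close> picks it out.\<close>

lemma mchains_icc_card:
  assumes "x \<sqsubseteq> y" "C \<in> mchains (icc x y)"
  shows "card C = Suc (len x y)"
proof -
  have bx: "bt \<sqsubseteq> x" and yt: "y \<sqsubseteq> tp" and bt: "bt \<sqsubseteq> y"
    using assms bt_le le_tp le_in by blast+
  obtain D where D: "D \<in> mchains (icc bt x)" using mchains_nonempty[OF icc_subset] .
  obtain E where E: "E \<in> mchains (icc y tp)" using mchains_nonempty[OF icc_subset] .
  \<comment> \<open>A maximal chain of the poset has n + 1 elements; x and y are each counted
    twice.\<close>
  have *: "card C + card D + card E = n + 3" if C: "C \<in> mchains (icc x y)" for C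
  proof -
    note 1 = mchains_concat[OF bx assms(1) D C]
    note 2 = mchains_concat[OF bt yt 1(1) E]
    have "card (D \<union> C \<union> E) = Suc n"
      using 2(1) graded max_chains_Restr[of "Field r"]
      by (simp add: has_rank_def icc_whole Restr_Field)
    then show ?thesis using 1(2) 2(2) by simp
  qed
  have "x \<in> C" "finite C"
    using mchains_icc_ends[OF assms(1,2)] assms(2) finite_subset[OF _ finite_icc]
    by (auto simp: mchains_def)
  then have "card C > 0" by (auto simp: card_gt_0_iff)
  then have c: "card C' = Suc (card C - 1)" if "C' \<in> mchains (icc x y)" for C'
    using *[OF that] *[OF assms(2)] by simp
  have "len x y = card C - 1"
    unfolding len_def interval_icc by (rule poset_rank_eqI[OF icc_subset c])
  then show ?thesis using c[OF assms(2)] by simp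
qed

lemma len_add:
  assumes "x \<sqsubseteq> w" "w \<sqsubseteq> y" shows "len x y = len x w + len w y"
proof -
  obtain D where D: "D \<in> mchains (icc x w)" using mchains_nonempty[OF icc_subset] .
  obtain E where E: "E \<in> mchains (icc w y)" using mchains_nonempty[OF icc_subset] .
  note 1 = mchains_concat[OF assms D E]
  show ?thesis
    using mchains_icc_card[OF le_trans[OF assms] 1(1)] 1(2)
      mchains_icc_card[OF assms(1) D] mchains_icc_card[OF assms(2) E] by simp
qed

lemma len_self [simp]: "x \<in> Field r \<Longrightarrow> len x x = 0"
  using len_add[of x x x] by simp

lemma len_pos: assumes "x \<sqsubset> y" shows "len x y > 0"
proof -
  obtain C where C: "C \<in> mchains (icc x y)" using mchains_nonempty[OF icc_subset] .
  then have "{x, y} \<subseteq> C" "finite C"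
    using mchains_icc_ends[OF _ C] assms finite_subset[OF _ finite_icc] by (auto simp: mchains_def)
  then have "card {x, y} \<le> card C" by (intro card_mono)
  then show ?thesis using mchains_icc_card[OF _ C] assms by simp
qed

lemma len_eq_0_iff: "x \<sqsubseteq> y \<Longrightarrow> len x y = 0 \<longleftrightarrow> x = y"
  using len_pos[of x y] le_in[of x y] by (cases "x = y") auto

text \<open>An element w of largest rank in [x, y) has nothing strictly between itself and y, so the
  maximal chain of [w, y] is {w, y}.\<close>

lemma coatom_above:
  assumes "x \<sqsubset> y"
  obtains w where "x \<sqsubseteq> w" "w \<sqsubset> y" "len w y = 1"
proof -
  have "x \<in> ico x y" using assms by (auto simp: ico_def dest: le_in)
  then have "Max (len x ` ico x y) \<in> len x ` ico x y" by (intro Max_in) auto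
  then obtain w where "w \<in> ico x y" "Max (len x ` ico x y) = len x w" by auto
  then have w: "w \<in> ico x y" "\<forall>v\<in>ico x y. len x v \<le> len x w"
    by (auto simp flip: \<open>Max _ = _\<close>)
  obtain C where C: "C \<in> mchains (icc w y)" using mchains_nonempty[OF icc_subset] .
  have "C \<subseteq> {w, y}"
  proof
    fix v assume "v \<in> C"
    then have v: "w \<sqsubseteq> v" "v \<sqsubseteq> y" using C by (auto simp: mchains_def icc_def)
    have xv: "x \<sqsubseteq> w" using w by (auto simp: ico_def)
    then have "len x v = len x w + len w v" "x \<sqsubseteq> v" using v len_add le_trans by blast+
    then show "v \<in> {w, y}" using w v len_pos[of w v] by (force simp: ico_def)
  qed
  then have "C = {w, y}" using mchains_icc_ends[OF _ C] w by (auto simp: ico_def)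
  then have "len w y = 1"
    using mchains_icc_card[OF _ C] w by (auto simp: ico_def)
  then show thesis using w that by (auto simp: ico_def)
qed

section \<open>Bottoms, ranks and boundaries of intervals\<close>

lemma bot_of_Restr:
  assumes "x \<in> X" "\<And>z. z \<in> X \<Longrightarrow> x \<sqsubseteq> z"
  shows "bot_of (Restr r X) = x"
proof -
  have "X \<subseteq> Field r" using assms(2) le_in by blast
  then have "minimal_elements (Restr r X) = {x}"
    using assms by (auto simp: minimal_elements_def Field_Restr intro: le_antisym)
  then show ?thesis by (simp add: bot_of_def)
qed

lemma bot_of_interval: "x \<sqsubseteq> y \<Longrightarrow> bot_of (interval r x y) = x"
  unfolding interval_icc by (rule bot_of_Restr) (auto simp: icc_def dest: le_in)

lemma interval_interval:
  assumes "x \<sqsubseteq> u" "u \<sqsubseteq> v" "v \<sqsubseteq> y"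
  shows "interval (interval r x y) u v = interval r u v"
proof -
  have "x \<sqsubseteq> z" "z \<sqsubseteq> y" if "u \<sqsubseteq> z" "z \<sqsubseteq> v" for z
    using that assms le_trans by blast+
  moreover have "x \<sqsubseteq> v" "u \<sqsubseteq> y" using assms le_trans by blast+
  ultimately show ?thesis using assms unfolding interval_def by blast
qed

lemma rk_interval: "x \<sqsubseteq> z \<Longrightarrow> z \<sqsubseteq> y \<Longrightarrow> rk (interval r x y) z = len x z"
  using le_trans[of x z y] interval_interval[of x x z y] le_in[of x z]
  by (simp add: rk_def bot_of_interval len_def)

lemma ico_subset: "ico x y \<subseteq> Field r"
  by (auto simp: ico_def dest: le_in)

text \<open>In an interval with top y every coatom is covered by y alone, so the condition on covers
  in \<open>boundary\<close> always holds there. Every element other than y lies below some coatom,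
  and what remains is the half-open interval.\<close>

lemma boundary_interval:
  assumes "x \<sqsubset> y"
  shows "boundary (interval r x y) = Restr r (ico x y)"
proof -
  let ?s = "interval r x y"
  have "{u. \<exists>w \<in> Field ?s. (u, w) \<in> ?s \<and> Suc (rk ?s w) = poset_rank ?s \<and> card {z. covers ?s w z} = 1}
      = ico x y" (is "?L = _")
  proof (intro equalityI subsetI)
    fix u assume "u \<in> ?L"
    then obtain w where w: "w \<in> icc x y" "(u, w) \<in> ?s" "Suc (rk ?s w) = len x y"
      by (auto simp: len_def)
    then have "Suc (len x w) = len x y" by (simp add: rk_interval icc_def)
    then have "w \<noteq> y" by auto
    then show "u \<in> ico x y"
      using w by (auto simp: interval_def ico_def icc_def intro: le_trans le_antisym)
  next
    fix u assume u: "u \<in> ico x y"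
    then obtain w where w: "u \<sqsubseteq> w" "w \<sqsubset> y" "len w y = 1"
      using coatom_above[of u y] by (auto simp: ico_def)
    have xw: "x \<sqsubseteq> w" using u w by (auto simp: ico_def intro: le_trans)
    have only: "v = w \<or> v = y" if "w \<sqsubseteq> v" "v \<sqsubseteq> y" for v
      using len_add[OF that] w(3) len_eq_0_iff[OF that(1)] len_eq_0_iff[OF that(2)] by auto
    have "{z. covers ?s w z} = {y}"
      using w xw only le_in[of w y] by (auto simp: covers_def interval_def intro: le_trans)
    moreover have "Suc (rk ?s w) = poset_rank ?s"
      using len_add[OF xw] w by (simp add: rk_interval xw flip: len_def)
    moreover have "(u, w) \<in> ?s" using w xw u by (auto simp: interval_def ico_def)
    ultimately show "u \<in> ?L" using w xw by (auto simp: icc_def intro!: bexI[of _ w])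
  qed
  moreover have "Restr ?s (ico x y) = Restr r (ico x y)"
    by (auto simp: interval_def ico_def)
  ultimately show ?thesis by (simp add: boundary_def)
qed

text \<open>Adding y turns a maximal chain of [x, y) into one of [x, y], which accounts for the drop
  of the rank by one.\<close>

lemma poset_rank_ico:
  assumes "x \<sqsubset> y" shows "poset_rank (Restr r (ico x y)) = len x y - 1"
proof (rule poset_rank_eqI[OF ico_subset])
  fix C assume C: "C \<in> mchains (ico x y)"
  then have C': "C \<in> Chains r" "C \<subseteq> ico x y" by (auto simp: mchains_def)
  have "insert y C \<in> Chains r"
    using C' assms le_in[of x y]
    by (intro ChainsI) (auto simp: ico_def subset_iff dest: ChainsD)
  moreover have "insert y C \<subseteq> icc x y"
    using C' assms le_in[of x y] by (auto simp: ico_def icc_def)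
  moreover have "v \<in> insert y C" if "v \<in> icc x y" "\<forall>c\<in>insert y C. v \<sqsubseteq> c \<or> c \<sqsubseteq> v" for v
    using that C by (auto simp: mchains_def icc_def ico_def)
  ultimately have "insert y C \<in> mchains (icc x y)" by (auto simp: mchains_def)
  then have "card (insert y C) = Suc (len x y)" using assms by (intro mchains_icc_card) auto
  moreover have "y \<notin> C" "finite C" using C' finite_subset[OF _ finite_ico] by (auto simp: ico_def)
  ultimately show "card C = Suc (len x y - 1)" using len_pos[OF assms] by simp
qed

lemma rk_ico:
  assumes "x \<sqsubset> y" "z \<in> ico x y"
  shows "rk (Restr r (ico x y)) z = len x z"
proof -
  have "bot_of (Restr r (ico x y)) = x"
    using assms by (intro bot_of_Restr) (auto simp: ico_def dest: le_in)
  moreover have "interval (Restr r (ico x y)) x z = interval r x z"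
    using assms le_in[of x y]
    by (auto simp: interval_def ico_def intro: le_trans le_antisym)
  ultimately show ?thesis by (simp add: rk_def len_def)
qed

end


section \<open>The ab-index as a sum over chains\<close>

definition amb :: "'k::field R_Psi" where
  "amb = letter a_letter - letter b_letter"

lemma scale_times: "scale k p * q = scale k (p * q)" for p q :: "'l list \<Rightarrow>\<^sub>0 'k::field"
  by (simp add: scale_def mult_map_scale_conv_mult mult.assoc)

lemma scale_minus_one: "scale (-1) p = - p" for p :: "'x \<Rightarrow>\<^sub>0 'k::field"
  by (rule poly_mapping_eqI) simp

lemma lin_ext_diff: "lin_ext f (p - q) = lin_ext f p - lin_ext f q"
  using lin_ext_add[of f "p - q" q] by simp

lemma single_Nil_one: "Poly_Mapping.single [] 1 = (1 :: 'l list \<Rightarrow>\<^sub>0 'k::field)"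
  by (metis single_one zero_list_def)

lemma sum_const_scale: "(\<Sum>i\<in>A. p) = scale (of_nat (card A)) p"
  by (induction A rule: infinite_finite_induct) (auto simp: pm.scale_left_distrib)

text \<open>
  \<open>ab_word S\<close> is the monomial \<open>u\<^sub>S\<close>. Moebius inversion turns \<open>\<Sum>S. \<beta>(S) u\<^sub>S\<close> into
  \<open>\<Sum>T. \<alpha>(T) flag_word T\<close>.
\<close>

definition flag_word :: "nat set \<Rightarrow> nat list \<Rightarrow> 'k::field R_Psi" where
  "flag_word T xs = (\<Prod>i\<leftarrow>xs. if i \<in> T then letter b_letter else amb)"

definition ab_word :: "nat set \<Rightarrow> nat list \<Rightarrow> ab list" where
  "ab_word S xs = map (\<lambda>i. if i \<in> S then b_letter else a_letter) xs"

lemma ab_word_Cons: "ab_word S (i # xs) = (if i \<in> S then b_letter else a_letter) # ab_word S xs"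
  by (simp add: ab_word_def)

lemma sum_Pow_insert:
  assumes "finite A" "x \<notin> A"
  shows "sum f (Pow (insert x A)) = sum f (Pow A) + (\<Sum>S\<in>Pow A. f (insert x S))"
proof -
  have "sum f (Pow (insert x A)) = sum f (Pow A) + sum f (insert x ` Pow A)"
    unfolding Pow_insert using assms by (intro sum.union_disjoint) auto
  also have "sum f (insert x ` Pow A) = (\<Sum>S\<in>Pow A. f (insert x S))"
    using assms(2) by (subst sum.reindex) (auto simp: inj_on_def)
  finally show ?thesis .
qed

text \<open>Multiplying out every factor a - b chooses the set S of positions that carry b.
  Positions in T must carry b, and each of the others in S contributes a sign.\<close>

lemma flag_word_expand:
  assumes "distinct xs" "finite T"
  shows "flag_word T xs = (\<Sum>S\<in>Pow (set xs).
    if T \<inter> set xs \<subseteq> S then Poly_Mapping.single (ab_word S xs) ((-1) ^ card (S - T)) else (0 :: 'k::field R_Psi))"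
  using assms(1)
proof (induction xs)
  case Nil
  show ?case by (simp add: flag_word_def ab_word_def single_Nil_one)
next
  case (Cons i xs)
  let ?f = "\<lambda>S. if T \<inter> set xs \<subseteq> S then Poly_Mapping.single (ab_word S xs) ((-1) ^ card (S - T)) else (0 :: 'k R_Psi)"
  let ?g = "\<lambda>S. if T \<inter> set (i # xs) \<subseteq> S then Poly_Mapping.single (ab_word S (i # xs)) ((-1) ^ card (S - T)) else (0 :: 'k R_Psi)"
  have i: "i \<notin> set xs" using Cons.prems by simp
  have word: "ab_word (insert i S) xs = ab_word S xs" for S
    unfolding ab_word_def using i by (intro map_cong) auto
  have A: "?g S = (if i \<in> T then 0 else letter a_letter * ?f S)" if "S \<in> Pow (set xs)" for S
  proof -
    have "i \<notin> S" using that i by auto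
    then show ?thesis by (auto simp: letter_single ab_word_def)
  qed
  have B: "?g (insert i S) = letter b_letter * (if i \<in> T then ?f S else - ?f S)" if "S \<in> Pow (set xs)" for S
  proof -
    have "i \<notin> S" "finite S" using that i finite_subset[of S "set xs"] by auto
    then have "card (insert i S - T) = (if i \<in> T then card (S - T) else Suc (card (S - T)))"
      by (simp add: insert_Diff_if)
    moreover have "T \<inter> set (i # xs) \<subseteq> insert i S \<longleftrightarrow> T \<inter> set xs \<subseteq> S" using i by auto
    ultimately show ?thesis
      using word by (auto simp: letter_single single_uminus ab_word_Cons)
  qed
  have "sum ?g (Pow (set (i # xs))) = sum ?g (Pow (set xs)) + (\<Sum>S\<in>Pow (set xs). ?g (insert i S))"
    using i by (simp only: list.set sum_Pow_insert finite_set not_False_eq_True)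
  also have "sum ?g (Pow (set xs)) = (\<Sum>S\<in>Pow (set xs). if i \<in> T then 0 else letter a_letter * ?f S)"
    by (rule sum.cong[OF refl A])
  also have "(\<Sum>S\<in>Pow (set xs). ?g (insert i S)) = (\<Sum>S\<in>Pow (set xs). letter b_letter * (if i \<in> T then ?f S else - ?f S))"
    by (rule sum.cong[OF refl B])
  also have "(\<Sum>S\<in>Pow (set xs). if i \<in> T then 0 else letter a_letter * ?f S) + \<dots> =
      (if i \<in> T then letter b_letter else amb) * sum ?f (Pow (set xs))"
    by (simp add: sum_distrib_left sum_negf amb_def left_diff_distrib sum_subtractf)
  also have "\<dots> = flag_word T (i # xs)"
    using Cons by (simp add: flag_word_def)
  finally show ?case by simp
qed

text \<open>After exchanging the sums over S and T, the inner sum is the expansion of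
  \<open>flag_word T\<close>. The coefficient \<alpha>(T) is then resolved into one summand per
  chain with rank set T.\<close>

lemma ab_index_chains:
  fixes r :: "'a rel"
  assumes "finite (Chains r)"
    and "\<And>C. C \<in> Chains r \<Longrightarrow> bot_of r \<notin> C \<Longrightarrow> rk r ` C \<subseteq> {1..poset_rank r}"
  shows "ab_index r = (\<Sum>C \<in> {C \<in> Chains r. bot_of r \<notin> C}.
    flag_word (rk r ` C) [1..<Suc (poset_rank r)] :: 'k::field_char_0 R_Psi)"
proof -
  let ?xs = "[1..<Suc (poset_rank r)]" and ?I = "{1..poset_rank r}"
  let ?K = "{C \<in> Chains r. bot_of r \<notin> C}"
  have I: "set ?xs = ?I" by auto
  have fin: "finite T" if "T \<subseteq> ?I" for T using that finite_subset by blast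
  have "ab_index r = (\<Sum>S\<in>Pow ?I. \<Sum>T\<in>Pow S.
      scale (of_nat (flag_f r T)) (Poly_Mapping.single (ab_word S ?xs) ((-1) ^ card (S - T))) :: 'k R_Psi)"
    unfolding ab_index_def flag_h_def ab_word_def[symmetric]
  proof (rule sum.cong[OF refl])
    fix S assume "S \<in> Pow ?I"
    show "Poly_Mapping.single (ab_word S ?xs) (of_int (\<Sum>T\<in>Pow S. (-1) ^ card (S - T) * int (flag_f r T))) =
      (\<Sum>T\<in>Pow S. scale (of_nat (flag_f r T)) (Poly_Mapping.single (ab_word S ?xs) ((-1) ^ card (S - T))) :: 'k R_Psi)"
      by (rule poly_mapping_eqI) (simp add: lookup_sum lookup_single when_def mult.commute)
  qed
  also have "\<dots> = (\<Sum>S\<in>Pow ?I. \<Sum>T\<in>Pow ?I. if T \<subseteq> S then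
      scale (of_nat (flag_f r T)) (Poly_Mapping.single (ab_word S ?xs) ((-1) ^ card (S - T))) else 0)"
  proof (rule sum.cong[OF refl])
    fix S assume S: "S \<in> Pow ?I"
    then have "Pow ?I \<inter> {T. T \<subseteq> S} = Pow S" by auto
    then show "(\<Sum>T\<in>Pow S. scale (of_nat (flag_f r T)) (Poly_Mapping.single (ab_word S ?xs) ((-1) ^ card (S - T))) :: 'k R_Psi)
      = (\<Sum>T\<in>Pow ?I. if T \<subseteq> S then
      scale (of_nat (flag_f r T)) (Poly_Mapping.single (ab_word S ?xs) ((-1) ^ card (S - T))) else 0)"
      by (simp add: sum.If_cases)
  qed
  also have "\<dots> = (\<Sum>T\<in>Pow ?I. scale (of_nat (flag_f r T)) (flag_word T ?xs))"
  proof (subst sum.swap, rule sum.cong[OF refl])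
    fix T assume T: "T \<in> Pow ?I"
    then have "T \<inter> ?I = T" "finite T" using fin by auto
    then show "(\<Sum>S\<in>Pow ?I. if T \<subseteq> S then scale (of_nat (flag_f r T)) (Poly_Mapping.single (ab_word S ?xs) ((-1) ^ card (S - T))) else 0)
       = scale (of_nat (flag_f r T)) (flag_word T ?xs :: 'k R_Psi)"
      by (subst flag_word_expand) (auto simp only: distinct_upt I pm.scale_sum_right if_distrib[of "scale _"] pm.scale_zero_right)
  qed
  also have "\<dots> = (\<Sum>T\<in>Pow ?I. \<Sum>C\<in>{C \<in> ?K. rk r ` C = T}. flag_word (rk r ` C) ?xs)"
  proof (rule sum.cong[OF refl])
    fix T
    have "(\<Sum>C\<in>{C \<in> ?K. rk r ` C = T}. flag_word (rk r ` C) ?xs :: 'k R_Psi)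
      = (\<Sum>C\<in>{C \<in> ?K. rk r ` C = T}. flag_word T ?xs)" by (rule sum.cong) auto
    also have "\<dots> = scale (of_nat (flag_f r T)) (flag_word T ?xs)"
      unfolding sum_const_scale by (simp add: flag_f_def conj_assoc)
    finally show "scale (of_nat (flag_f r T)) (flag_word T ?xs) =
      (\<Sum>C\<in>{C \<in> ?K. rk r ` C = T}. flag_word (rk r ` C) ?xs :: 'k R_Psi)" ..
  qed
  \<comment> \<open>The second assumption puts the rank set of each chain into
    \<open>Pow ?I\<close>, so each chain is counted in exactly one group.\<close>
  also have "\<dots> = (\<Sum>C\<in>?K. flag_word (rk r ` C) ?xs)"
    using assms by (intro sum.group) auto
  finally show ?thesis .
qed

lemma flag_word_cong:
  "(\<And>i. i \<in> set xs \<Longrightarrow> i \<in> T \<longleftrightarrow> i \<in> U) \<Longrightarrow> flag_word T xs = flag_word U xs"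
  unfolding flag_word_def by (simp cong: map_cong)

lemma flag_word_empty: "flag_word {} [1..<m] = amb ^ (m - 1)"
  by (simp add: flag_word_def map_replicate_const)

lemma flag_word_shift:
  "flag_word T (map ((+) k) xs) = flag_word {i. k + i \<in> T} xs"
  by (simp add: flag_word_def comp_def)

text \<open>The list of ranks is cut at k: no rank below k is hit, k itself gives b, and the ranks
  above k are those of the upper interval shifted by k.\<close>

lemma flag_word_insert:
  assumes "0 < k" "0 < m" "0 \<notin> U"
  shows "flag_word (insert k ((+) k ` U)) [1..<k + m] =
    amb ^ (k - 1) * letter b_letter * (flag_word U [1..<m] :: 'k::field R_Psi)"
proof -
  let ?T = "insert k ((+) k ` U)"
  have "[1..<k + m] = [1..<k] @ [k..<k + m]" using assms by (metis One_nat_def Suc_leI upt_add_eq_append le_add_diff_inverse)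
  also have "[k..<k + m] = k # map ((+) k) [1..<m]"
    using assms by (subst upt_conv_Cons) (auto intro!: nth_equalityI)
  finally have "flag_word ?T [1..<k + m] = flag_word ?T [1..<k] * letter b_letter * (flag_word ?T (map ((+) k) [1..<m]) :: 'k R_Psi)"
    by (simp add: flag_word_def mult.assoc)
  also have "flag_word ?T (map ((+) k) [1..<m]) = (flag_word U [1..<m] :: 'k R_Psi)"
    unfolding flag_word_shift by (rule flag_word_cong) auto
  also have "flag_word ?T [1..<k] = (amb ^ (k - 1) :: 'k R_Psi)"
    using assms by (subst flag_word_cong[of _ _ "{}"]) (auto simp: flag_word_empty[of k, simplified])
  finally show ?thesis .
qed

section \<open>The polynomials in c and d among the ab-polynomials\<close>

definition cd_span :: "'k::field R_Psi set" where "cd_span = range cd_to_ab"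

lemma cd_span_add: "p \<in> cd_span \<Longrightarrow> q \<in> cd_span \<Longrightarrow> p + q \<in> cd_span"
  unfolding cd_span_def cd_to_ab_alt by (auto simp flip: lin_ext_add)

lemma cd_span_scale: "p \<in> cd_span \<Longrightarrow> scale k p \<in> cd_span"
  unfolding cd_span_def cd_to_ab_alt by (auto simp flip: lin_ext_scale)

lemma cd_span_zero: "0 \<in> cd_span"
  unfolding cd_span_def cd_to_ab_alt by (rule range_eqI[of _ _ 0]) simp

lemma cd_span_sum: "(\<And>i. i \<in> I \<Longrightarrow> f i \<in> cd_span) \<Longrightarrow> sum f I \<in> cd_span"
  by (induction I rule: infinite_finite_induct) (auto intro: cd_span_add cd_span_zero)

lemma cd_span_one: "1 \<in> cd_span"
  unfolding cd_span_def
  by (rule range_eqI[of _ _ 1]) (simp add: cd_to_ab_single_Nil zero_list_def flip: single_one)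

lemma cd_span_letter: "p \<in> cd_span \<Longrightarrow> cd_letter_to_ab l * p \<in> cd_span"
  unfolding cd_span_def by (auto simp flip: cd_to_ab_letter)

lemma amb_square:
  "amb ^ 2 = cd_letter_to_ab c_letter * cd_letter_to_ab c_letter
     - (cd_letter_to_ab d_letter + cd_letter_to_ab d_letter)"
  by (simp add: amb_def power2_eq_square algebra_simps)

lemma cd_span_amb_even: "p \<in> cd_span \<Longrightarrow> amb ^ (2 * k) * p \<in> cd_span"
proof (induction k)
  case (Suc k)
  have "amb ^ 2 * q \<in> cd_span" if "q \<in> cd_span" for q :: "'a R_Psi"
  proof -
    have "amb ^ 2 * q = cd_letter_to_ab c_letter * (cd_letter_to_ab c_letter * q)
      + scale (-1) (cd_letter_to_ab d_letter * q + cd_letter_to_ab d_letter * q)"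
      unfolding amb_square scale_minus_one by (simp add: algebra_simps del: cd_letter_to_ab.simps)
    then show ?thesis
      by (simp only:) (intro cd_span_add cd_span_scale cd_span_letter that)
  qed
  from this[OF Suc.IH[OF Suc.prems]] show ?case
    by (simp add: power_add mult.assoc power2_eq_square)
qed simp

section \<open>The middle part of the coproduct on products with b and with powers of a - b\<close>

lemma lin_ext_mid_b:
  assumes "lin_ext mid p = (\<Sum>i\<in>I. add_e (f i) \<otimes>\<^sub>K add_e (g i))"
  shows "lin_ext mid (letter b_letter * p) = one_e \<otimes>\<^sub>K add_e p +
    (\<Sum>i\<in>I. add_e (letter b_letter * f i) \<otimes>\<^sub>K add_e (g i))"
proof -
  have "prep b_letter (lin_ext mid p) = (\<Sum>i\<in>I. prep b_letter (add_e (f i) \<otimes>\<^sub>K add_e (g i)))"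
    unfolding assms prep_def lin_ext_sum ..
  then show ?thesis by (simp add: lin_mid prep_tensor)
qed

text \<open>Prepending a and prepending b both create the term 1 \<otimes> p. In the difference
  these cancel, so powers of a - b simply move into the left factors.\<close>

lemma lin_ext_mid_amb:
  assumes "lin_ext mid p = (\<Sum>i\<in>I. add_e (f i) \<otimes>\<^sub>K add_e (g i))"
  shows "lin_ext mid (amb ^ k * p) = (\<Sum>i\<in>I. add_e (amb ^ k * f i) \<otimes>\<^sub>K add_e (g i))"
proof (induction k)
  case (Suc k)
  let ?q = "amb ^ k * p"
  have "lin_ext mid (amb * ?q) = prep a_letter (lin_ext mid ?q) - prep b_letter (lin_ext mid ?q)"
    by (simp add: amb_def left_diff_distrib lin_ext_diff lin_mid)
  also have "\<dots> = (\<Sum>i\<in>I. prep a_letter (add_e (amb ^ k * f i) \<otimes>\<^sub>K add_e (g i))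
     - prep b_letter (add_e (amb ^ k * f i) \<otimes>\<^sub>K add_e (g i)))"
    unfolding Suc prep_def lin_ext_sum sum_subtractf ..
  also have "\<dots> = (\<Sum>i\<in>I. add_e (amb ^ Suc k * f i) \<otimes>\<^sub>K add_e (g i))"
  proof (rule sum.cong[OF refl])
    fix i
    have "add_e (letter a_letter * q) \<otimes>\<^sub>K s = add_e (amb * q) \<otimes>\<^sub>K s + add_e (letter b_letter * q) \<otimes>\<^sub>K s" 
      for q :: "'a R_Psi" and s :: "'a R_Psi_e"
      by (simp add: amb_def add_e_def flip: tensor_add_left lin_ext_add distrib_right)
    then show "prep a_letter (add_e (amb ^ k * f i) \<otimes>\<^sub>K add_e (g i))
     - prep b_letter (add_e (amb ^ k * f i) \<otimes>\<^sub>K add_e (g i)) = add_e (amb ^ Suc k * f i) \<otimes>\<^sub>K add_e (g i)"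
      by (simp add: prep_tensor mult.assoc)
  qed
  finally show ?case by (simp add: mult.assoc)
qed (simp add: assms)

text \<open>The outer terms will be the summands for the two end points of an interval; the middle
  part has to account for the interior elements.\<close>

lemma coproduct_add_e:
  "coproduct (add_e p) = Poly_Mapping.single e_letter 1 \<otimes>\<^sub>K add_e p + lin_ext mid p +
     add_e p \<otimes>\<^sub>K Poly_Mapping.single e_letter 1"
proof -
  have "coproduct (add_e p) = lin_ext (\<lambda>v. coproduct_monomial (word v)) p"
    by (rule lin_ext_eqI) (simp_all add: coproduct_def add_e_def lin_ext_add lin_ext_scale)
  moreover have "Poly_Mapping.single e_letter 1 \<otimes>\<^sub>K add_e p + lin_ext mid p +
      add_e p \<otimes>\<^sub>K Poly_Mapping.single e_letter 1 = lin_ext (\<lambda>v. coproduct_monomial (word v)) p"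
    by (rule lin_ext_eqI)
      (simp_all add: add_e_def lin_ext_add lin_ext_scale tensor_add_left tensor_add_right
        tensor_scale_left tensor_scale_right tensor_single mid_def pm.scale_right_distrib)
  ultimately show ?thesis by simp
qed

lemma cde_to_abe_add_e: "cde_to_abe (add_e p) = add_e (cd_to_ab p)"
proof -
  have "add_e (cd_to_ab p) = lin_ext (\<lambda>v. add_e (cd_prod v)) p"
    by (rule lin_ext_eqI) (simp_all add: add_e_def cd_to_ab_alt lin_ext_add lin_ext_scale)
  moreover have "cde_to_abe (add_e p) = lin_ext (\<lambda>v. add_e (cd_prod v)) p"
    by (rule lin_ext_eqI) (simp_all add: cde_to_abe_def add_e_def cd_to_ab_alt lin_ext_add lin_ext_scale)
  ultimately show ?thesis by simp
qed

text \<open>The \<open>THE\<close> in \<open>cd_index\<close> needs existence, which is membership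
  in \<open>cd_span\<close>, and uniqueness, which is injectivity of
  \<open>cd_to_ab\<close>.\<close>

lemma cd_to_ab_cd_index:
  assumes "ab_index r \<in> (cd_span :: 'k::field_char_0 R_Psi set)"
  shows "cd_to_ab (cd_index r :: 'k R_Phi) = ab_index r"
proof -
  obtain p :: "'k R_Phi" where p: "cd_to_ab p = ab_index r" using assms by (auto simp: cd_span_def)
  show ?thesis
    unfolding cd_index_def
    by (rule theI[where a = p]) (use p in \<open>auto intro: injD[OF inj_cd_to_ab]\<close>)
qed

lemma Phi_eq_ab_index:
  assumes "poset_rank r > 0" "ab_index (boundary r) \<in> (cd_span :: 'k::field_char_0 R_Psi set)"
  shows "Phi r = (add_e (ab_index (boundary r)) :: 'k R_Psi_e)"
  using assms by (simp add: Phi_def cde_index_def cde_to_abe_add_e cd_to_ab_cd_index)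


section \<open>The ab-index of an interval and its coproduct\<close>

context bounded_graded_poset begin

lemma ioo_len_less: "z \<in> ioo x y \<Longrightarrow> len z y < len x y"
  using len_add[of x z y] len_pos[of x z] by (auto simp: ioo_def)

lemma ioo_trans:
  assumes "z \<in> ioo x y" shows "ioo x z \<subseteq> ioo x y" "ioo z y \<subseteq> ioo x y"
  using assms by (auto simp: ioo_def intro: le_trans dest: le_antisym)

definition open_chains :: "'a \<Rightarrow> 'a \<Rightarrow> 'a set set" where
  "open_chains x y = {C \<in> Chains r. C \<subseteq> ioo x y}"

text \<open>For x < y this is the ab-index of the boundary of [x, y], by
  \<open>ab_index_boundary\<close>. For an element x = y of the poset the value is 1 and not e;
  \<open>Phi_interval\<close> treats that case apart.\<close>

definition Psi :: "'a \<Rightarrow> 'a \<Rightarrow> 'k::field R_Psi" where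
  "Psi x y = (\<Sum>C\<in>open_chains x y. flag_word (len x ` C) [1..<len x y])"

lemma finite_open_chains: "finite (open_chains x y)"
  unfolding open_chains_def by (rule finite_subset[of _ "Pow (ioo x y)"]) auto

lemma ab_index_boundary:
  assumes "x \<sqsubset> y"
  shows "ab_index (boundary (interval r x y)) = (Psi x y :: 'k::field_char_0 R_Psi)"
proof -
  let ?R = "Restr r (ico x y)"
  have bot: "bot_of ?R = x"
    using assms by (intro bot_of_Restr) (auto simp: ico_def dest: le_in)
  have chains: "{C \<in> Chains ?R. bot_of ?R \<notin> C} = open_chains x y"
    unfolding bot open_chains_def Chains_Restr by (auto simp: ico_def ioo_def)
  have rank: "Suc (poset_rank ?R) = len x y"
    using poset_rank_ico[OF assms] len_pos[OF assms] by simp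
  have rk: "rk ?R ` C = len x ` C" if "C \<in> open_chains x y" for C
    using that rk_ico[OF assms] by (intro image_cong) (auto simp: open_chains_def ioo_def ico_def)
  have "ab_index ?R = (\<Sum>C \<in> {C \<in> Chains ?R. bot_of ?R \<notin> C}.
    flag_word (rk ?R ` C) [1..<Suc (poset_rank ?R)] :: 'k R_Psi)"
  proof (rule ab_index_chains)
    show "finite (Chains ?R)"
      unfolding Chains_Restr by (rule finite_subset[of _ "Pow (ico x y)"]) auto
    fix C assume "C \<in> Chains ?R" "bot_of ?R \<notin> C"
    then have C: "C \<in> open_chains x y" using chains by auto
    have "len x c \<in> {1..poset_rank ?R}" if "c \<in> C" for c
    proof -
      have c: "c \<in> ioo x y" using that C by (auto simp: open_chains_def)
      then have "0 < len x c" "0 < len c y" "len x y = len x c + len c y"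
        using len_pos len_add by (auto simp: ioo_def)
      then show ?thesis using rank by simp
    qed
    then show "rk ?R ` C \<subseteq> {1..poset_rank ?R}" unfolding rk[OF C] by auto
  qed
  also have "\<dots> = Psi x y"
    unfolding chains rank Psi_def by (rule sum.cong[OF refl]) (simp only: rk)
  finally show ?thesis by (simp add: boundary_interval[OF assms])
qed

section \<open>Splitting off the least element of a chain\<close>

lemma finite_chain_has_min:
  assumes "C \<in> Chains r" "finite C" "C \<noteq> {}"
  obtains z where "z \<in> C" "\<And>c. c \<in> C \<Longrightarrow> z \<sqsubseteq> c"
proof -
  have "\<exists>z\<in>C. \<forall>c\<in>C. z \<sqsubseteq> c"
    using assms(2,3,1)
  proof (induction rule: finite_ne_induct)
    case (singleton x)
    then show ?case by (auto simp: Chains_def)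
  next
    case (insert x F)
    then have "F \<in> Chains r" by (auto simp: Chains_def)
    with insert.IH obtain z where z: "z \<in> F" "\<forall>c\<in>F. z \<sqsubseteq> c" by blast
    have "x \<sqsubseteq> z \<or> z \<sqsubseteq> x" "x \<sqsubseteq> x"
      using insert.prems z(1) by (auto simp: Chains_def)
    then show ?case using z by (auto intro: le_trans)
  qed
  then show thesis using that by blast
qed

text \<open>The pair can be recovered from the chain: z is its least element and C is the
  rest.\<close>

lemma nonempty_open_chains:
  "bij_betw (\<lambda>(z, C). insert z C) (SIGMA z:ioo x y. open_chains z y) (open_chains x y - {{}})"
  unfolding bij_betw_def
proof
  show "inj_on (\<lambda>(z, C). insert z C) (SIGMA z:ioo x y. open_chains z y)"
  proof (intro inj_onI, clarify)
    fix z C z' C'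
    assume *: "C \<in> open_chains z y" "C' \<in> open_chains z' y" "insert z C = insert z' C'"
      and z: "z \<in> ioo x y" "z' \<in> ioo x y"
    have C: "C \<subseteq> ioo z y" "C' \<subseteq> ioo z' y" using * by (auto simp: open_chains_def)
    have "z \<in> insert z' C'" "z' \<in> insert z C" using *(3) by auto
    then have "z = z'" using C by (auto simp: ioo_def dest: le_antisym)
    moreover have "z \<notin> C" "z' \<notin> C'" using C by (auto simp: ioo_def)
    ultimately show "z = z' \<and> C = C'" using *(3) by auto
  qed
  show "(\<lambda>(z, C). insert z C) ` (SIGMA z:ioo x y. open_chains z y) = open_chains x y - {{}}"
  proof (intro equalityI subsetI)
    fix D assume "D \<in> (\<lambda>(z, C). insert z C) ` (SIGMA z:ioo x y. open_chains z y)"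
    then obtain z C where D: "D = insert z C" "z \<in> ioo x y" "C \<in> open_chains z y" by auto
    have "insert z C \<in> Chains r"
      using D(2,3) by (intro ChainsI) (auto simp: open_chains_def ioo_def dest: ChainsD le_in)
    then show "D \<in> open_chains x y - {{}}"
      using D ioo_trans(2)[OF D(2)] by (auto simp: open_chains_def)
  next
    fix D assume "D \<in> open_chains x y - {{}}"
    then have D: "D \<in> Chains r" "D \<subseteq> ioo x y" "D \<noteq> {}" by (auto simp: open_chains_def)
    then obtain z where z: "z \<in> D" "\<And>c. c \<in> D \<Longrightarrow> z \<sqsubseteq> c"
      using finite_chain_has_min[of D] finite_subset[OF _ finite_ioo] by blast
    have "D - {z} \<in> open_chains z y"
      using D z by (auto simp: open_chains_def ioo_def Chains_def)
    moreover have "D = insert z (D - {z})" using z by auto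
    ultimately show "D \<in> (\<lambda>(z, C). insert z C) ` (SIGMA z:ioo x y. open_chains z y)"
      using D z by (intro image_eqI[of _ _ "(z, D - {z})"]) auto
  qed
qed

lemma Psi_rec:
  "Psi x y = amb ^ (len x y - 1) +
     (\<Sum>z\<in>ioo x y. amb ^ (len x z - 1) * letter b_letter * Psi z y :: 'k::field R_Psi)"
proof -
  let ?f = "\<lambda>C. flag_word (len x ` C) [1..<len x y] :: 'k R_Psi"
  have f: "?f (insert z C) = amb ^ (len x z - 1) * letter b_letter * flag_word (len z ` C) [1..<len z y]"
    if "z \<in> ioo x y" "C \<in> open_chains z y" for z C
  proof -
    have z: "x \<sqsubset> z" "z \<sqsubset> y" using that by (auto simp: ioo_def)
    have C: "z \<sqsubset> c" if "c \<in> C" for c using that \<open>C \<in> _\<close> by (auto simp: open_chains_def ioo_def)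
    \<comment> \<open>Ranks over x are ranks over z shifted by \<open>len x z\<close>, as
      \<open>flag_word_insert\<close> requires.\<close>
    have im: "len x ` C = (+) (len x z) ` len z ` C"
      unfolding image_image using z C len_add by (intro image_cong) auto
    have ln: "len x y = len x z + len z y" using z len_add by auto
    have 0: "0 \<notin> len z ` C" using len_pos C by force
    show ?thesis
      unfolding image_insert im ln by (rule flag_word_insert[OF len_pos[OF z(1)] len_pos[OF z(2)] 0])
  qed
  have "{} \<in> open_chains x y" by (auto simp: open_chains_def Chains_def)
  then have "Psi x y = ?f {} + sum ?f (open_chains x y - {{}})"
    unfolding Psi_def by (rule sum.remove[OF finite_open_chains])
  also have "sum ?f (open_chains x y - {{}}) = (\<Sum>(z, C)\<in>(SIGMA z:ioo x y. open_chains z y). ?f (insert z C))"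
    by (subst sum.reindex_bij_betw[OF nonempty_open_chains, symmetric]) (simp add: case_prod_unfold)
  also have "\<dots> = (\<Sum>z\<in>ioo x y. \<Sum>C\<in>open_chains z y. ?f (insert z C))"
    by (subst sum.Sigma) (auto simp: finite_open_chains)
  also have "\<dots> = (\<Sum>z\<in>ioo x y. amb ^ (len x z - 1) * letter b_letter * Psi z y)"
    unfolding Psi_def sum_distrib_left by (intro sum.cong refl f)
  finally show ?thesis by (simp add: flag_word_empty del: One_nat_def)
qed

text \<open>Both sides sum over all x < z < w < y.\<close>

lemma sum_ioo_swap:
  "(\<Sum>z\<in>ioo x y. \<Sum>w\<in>ioo z y. h z w) = (\<Sum>w\<in>ioo x y. \<Sum>z\<in>ioo x w. h z w)"
proof -
  have 1: "ioo z y = {w \<in> ioo x y. z \<sqsubset> w}" if "z \<in> ioo x y" for z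
    using that ioo_trans[of z x y] by (auto simp: ioo_def)
  have 2: "ioo x w = {z \<in> ioo x y. z \<sqsubset> w}" if "w \<in> ioo x y" for w
    using that ioo_trans[of w x y] by (auto simp: ioo_def)
  have "(\<Sum>z\<in>ioo x y. \<Sum>w\<in>ioo z y. h z w) = (\<Sum>z\<in>ioo x y. \<Sum>w\<in>{w \<in> ioo x y. z \<sqsubset> w}. h z w)"
    by (rule sum.cong[OF refl sum.cong[OF 1 refl]])
  also have "\<dots> = (\<Sum>w\<in>ioo x y. \<Sum>z\<in>{z \<in> ioo x y. z \<sqsubset> w}. h z w)"
    by (rule sum.swap_restrict) auto
  also have "\<dots> = (\<Sum>w\<in>ioo x y. \<Sum>z\<in>ioo x w. h z w)"
    by (rule sum.cong[OF refl sum.cong[OF 2[symmetric] refl]])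
  finally show ?thesis .
qed

text \<open>Induction on the length through \<open>Psi_rec\<close>: the derivation kills the powers
  of t, and in each remaining term it hits either the explicit b or the factor
  \<open>Psi z y\<close>.\<close>

lemma lin_ext_mid_Psi:
  "lin_ext mid (Psi x y) = (\<Sum>z\<in>ioo x y. add_e (Psi x z) \<otimes>\<^sub>K add_e (Psi z y :: 'k::field R_Psi))"
proof (induction "len x y" arbitrary: x rule: less_induct)
  case less
  let ?t = "\<lambda>x z. amb ^ (len x z - 1) :: 'k R_Psi" and ?b = "letter b_letter :: 'k R_Psi"
  \<comment> \<open>A power of t is that power times 1, and the image of 1 is an empty sum; the
    index type is arbitrary.\<close>
  have mid_one: "lin_ext mid 1 = (\<Sum>i\<in>({} :: nat set). add_e 0 \<otimes>\<^sub>K add_e (0 :: 'k R_Psi))"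
    by (simp add: mid_def flip: single_Nil_one)
  have tens_sum: "sum f A \<otimes>\<^sub>K q = (\<Sum>a\<in>A. f a \<otimes>\<^sub>K q)" for f :: "'a \<Rightarrow> 'k R_Psi_e" and q :: "'k R_Psi_e" and A
    by (simp add: tensor_lin lin_ext_sum)
  have step: "lin_ext mid (?t x z * ?b * Psi z y) = add_e (?t x z) \<otimes>\<^sub>K add_e (Psi z y) +
      (\<Sum>w\<in>ioo z y. add_e (?t x z * ?b * Psi z w) \<otimes>\<^sub>K add_e (Psi w y))" if z: "z \<in> ioo x y" for z
  proof -
    \<comment> \<open>The index \<open>None\<close> stands for the term in which the explicit b is
      removed, \<open>Some w\<close> for the terms given by the induction hypothesis for
      \<open>Psi z y\<close>.\<close>
    define f where "f i = (case i of None \<Rightarrow> 1 | Some w \<Rightarrow> ?b * Psi z w)" for i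
    define g where "g i = (case i of None \<Rightarrow> Psi z y | Some w \<Rightarrow> (Psi w y :: 'k R_Psi))" for i :: "'a option"
    have insertNone: "(\<Sum>i\<in>insert None (Some ` ioo z y). h i) = h None + (\<Sum>w\<in>ioo z y. h (Some w))"
      for h :: "'a option \<Rightarrow> ab eword \<times> ab eword \<Rightarrow>\<^sub>0 'k"
      by (subst sum.insert) (auto simp: sum.reindex)
    have one: "one_e = add_e (1 :: 'k R_Psi)"
      by (simp add: add_e_def flip: single_Nil_one)
    have "lin_ext mid (?b * Psi z y) = (\<Sum>i\<in>insert None (Some ` ioo z y). add_e (f i) \<otimes>\<^sub>K add_e (g i))"
      unfolding insertNone using lin_ext_mid_b[OF less[OF ioo_len_less[OF z]]]
      by (simp add: f_def g_def one)
    from lin_ext_mid_amb[OF this, of "len x z - 1"] show ?thesis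
      unfolding insertNone by (simp add: f_def g_def mult.assoc)
  qed
  have "lin_ext mid (Psi x y) = (\<Sum>z\<in>ioo x y. add_e (?t x z) \<otimes>\<^sub>K add_e (Psi z y)) +
      (\<Sum>z\<in>ioo x y. \<Sum>w\<in>ioo z y. add_e (?t x z * ?b * Psi z w) \<otimes>\<^sub>K add_e (Psi w y))"
    using lin_ext_mid_amb[OF mid_one, of "len x y - 1"]
    by (subst Psi_rec) (simp add: lin_ext_add lin_ext_sum step sum.distrib del: One_nat_def cong: sum.cong)
  also have "\<dots> = (\<Sum>w\<in>ioo x y. add_e (?t x w) \<otimes>\<^sub>K add_e (Psi w y) +
      (\<Sum>z\<in>ioo x w. add_e (?t x z * ?b * Psi z w) \<otimes>\<^sub>K add_e (Psi w y)))"
    by (simp only: sum_ioo_swap sum.distrib)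
  \<comment> \<open>For fixed w the left factors add up to the recursion for
    \<open>Psi x w\<close>.\<close>
  also have "\<dots> = (\<Sum>w\<in>ioo x y. add_e (Psi x w) \<otimes>\<^sub>K add_e (Psi w y))"
  proof (rule sum.cong[OF refl])
    fix w
    show "add_e (?t x w) \<otimes>\<^sub>K add_e (Psi w y) +
      (\<Sum>z\<in>ioo x w. add_e (?t x z * ?b * Psi z w) \<otimes>\<^sub>K add_e (Psi w y)) = add_e (Psi x w) \<otimes>\<^sub>K add_e (Psi w y)"
      by (subst (3) Psi_rec) (simp add: add_e_def lin_ext_add lin_ext_sum tensor_add_left tens_sum)
  qed
  finally show ?case .
qed

section \<open>Existence of the cd-index\<close>

text \<open>This is (\<zeta> + 1) v = 2 (\<zeta> - 1), read at a pair x < y and solved for v(x, y).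
  On the diagonal the recursion returns 1 where the Cayley transform has 0; only pairs x < y
  matter.\<close>

function cayley :: "'a \<Rightarrow> 'a \<Rightarrow> 'k::field" where
  "cayley x y = 1 - (\<Sum>z\<in>ioo x y. cayley z y) / 2"
  by auto
termination
  by (relation "measure (\<lambda>(x, y). len x y)") (auto intro: ioo_len_less)

declare cayley.simps [simp del]

end

locale bounded_eulerian_poset = bounded_graded_poset +
  assumes alternating: "x \<sqsubset> y \<Longrightarrow> (\<Sum>z\<in>icc x y. (-1 :: int) ^ len bt z) = 0"
begin

text \<open>The factor \<open>(-1) ^ len bt y\<close> turns ranks measured from the bottom into
  lengths up to y. Removing z = y, whose sign is 1, leaves -1. In other words, \<zeta> twisted by
  signs is inverse to \<zeta>.\<close>

lemma alternating_len:
  assumes "x \<sqsubset> y"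
  shows "(\<Sum>z\<in>ico x y. (-1 :: 'k::comm_ring_1) ^ len z y) = -1"
proof -
  have bt: "bt \<sqsubseteq> z" if "z \<in> icc x y" for z using that by (auto simp: icc_def intro: bt_le dest: le_in)
  have "(\<Sum>z\<in>icc x y. (-1 :: int) ^ len z y) = (\<Sum>z\<in>icc x y. (-1) ^ len bt y * (-1) ^ len bt z)"
  proof (rule sum.cong[OF refl])
    fix z assume z: "z \<in> icc x y"
    then have "len bt y = len bt z + len z y" using bt[OF z] by (intro len_add) (auto simp: icc_def)
    then show "(-1 :: int) ^ len z y = (-1) ^ len bt y * (-1) ^ len bt z"
      by (simp add: power_add flip: power_mult_distrib)
  qed
  also have "\<dots> = 0" using alternating[OF assms] by (simp flip: sum_distrib_left)
  finally have "of_int (\<Sum>z\<in>icc x y. (-1 :: int) ^ len z y) = (0 :: 'k)" by simp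
  moreover have "icc x y = insert y (ico x y)" "y \<notin> ico x y"
    using assms by (auto simp: icc_def ico_def dest: le_in)
  moreover have "y \<in> Field r" using assms le_in by blast
  ultimately show ?thesis by (simp add: add_eq_0_iff)
qed

text \<open>With e = (-1) ^ len, both v and - e v solve the recursion of \<open>cayley\<close>.
  Their difference g = (1 + e) v solves the homogeneous one and vanishes by induction on the length.
  At even length 1 + e = 2.\<close>

lemma cayley_even:
  assumes "x \<sqsubset> y" "even (len x y)"
  shows "cayley x y = (0 :: 'k::field_char_0)"
proof -
  let ?v = "\<lambda>x. cayley x y :: 'k" and ?e = "\<lambda>x. (-1 :: 'k) ^ len x y"
  define g where "g x = (1 + ?e x) * ?v x" for x
  have rec: "2 * ?v x + (\<Sum>z\<in>ioo x y. ?v z) = 2" for x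
    by (subst cayley.simps) simp
  have gsum: "2 * g w + (\<Sum>z\<in>ioo w y. g z) = 0" if w: "w \<sqsubset> y" for w
  proof -
    have ico: "ico w y = insert w (ioo w y)" "w \<notin> ioo w y"
      using w by (auto simp: ico_def ioo_def dest: le_in)
    have 1: "ioo z y = {w' \<in> ioo w y. z \<sqsubset> w'}" if "z \<in> ico w y" for z
      using that by (auto simp: ioo_def ico_def intro: le_trans dest: le_antisym)
    have 2: "ico w u = {z \<in> ico w y. z \<sqsubset> u}" if "u \<in> ioo w y" for u
      using that by (auto simp: ioo_def ico_def intro: le_trans dest: le_antisym)
    \<comment> \<open>The exchange isolates the signs over [w, u), whose sum is -1 by
      \<open>alternating_len\<close>.\<close>
    have "(\<Sum>z\<in>ico w y. \<Sum>u\<in>ioo z y. ?e z * ?v u) = (\<Sum>u\<in>ioo w y. \<Sum>z\<in>ico w u. ?e z * ?v u)"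
      using sum.swap_restrict[of "ico w y" "ioo w y" "\<lambda>z u. ?e z * ?v u" "\<lambda>z u. z \<sqsubset> u"]
      by (simp add: 1 2 cong: sum.cong)
    also have "\<dots> = (\<Sum>u\<in>ioo w y. - (?e u * ?v u))"
    proof (rule sum.cong[OF refl])
      fix u assume u: "u \<in> ioo w y"
      have "(\<Sum>z\<in>ico w u. ?e z * ?v u) = (\<Sum>z\<in>ico w u. (-1) ^ len z u * (?e u * ?v u))"
      proof (rule sum.cong[OF refl])
        fix z assume "z \<in> ico w u"
        then have "len z y = len z u + len u y" using u by (intro len_add) (auto simp: ico_def ioo_def)
        then show "?e z * ?v u = (-1) ^ len z u * (?e u * ?v u)" by (simp add: power_add)
      qed
      also have "\<dots> = (\<Sum>z\<in>ico w u. (-1) ^ len z u) * (?e u * ?v u)"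
        by (rule sum_distrib_right[symmetric])
      also have "\<dots> = - (?e u * ?v u)"
        using u by (subst alternating_len) (auto simp: ioo_def)
      finally show "(\<Sum>z\<in>ico w u. ?e z * ?v u) = - (?e u * ?v u)" .
    qed
    finally have swap: "(\<Sum>z\<in>ico w y. \<Sum>u\<in>ioo z y. ?e z * ?v u) = - (\<Sum>u\<in>ioo w y. ?e u * ?v u)"
      by (simp add: sum_negf)
    \<comment> \<open>The recursion at z, multiplied by the sign of z and summed over [w, y),
      becomes the recursion for - e v at w.\<close>
    have "- 2 = (\<Sum>z\<in>ico w y. ?e z * 2)"
      by (simp add: alternating_len[OF w] flip: sum_distrib_right)
    also have "\<dots> = (\<Sum>z\<in>ico w y. 2 * (?e z * ?v z) + (\<Sum>u\<in>ioo z y. ?e z * ?v u))"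
    proof (rule sum.cong[OF refl])
      fix z
      have "?e z * 2 = ?e z * (2 * ?v z + (\<Sum>u\<in>ioo z y. ?v u))" by (simp only: rec)
      then show "?e z * 2 = 2 * (?e z * ?v z) + (\<Sum>u\<in>ioo z y. ?e z * ?v u)"
        by (simp only: distrib_left sum_distrib_left mult.left_commute)
    qed
    also have "\<dots> = 2 * (\<Sum>z\<in>ico w y. ?e z * ?v z) - (\<Sum>u\<in>ioo w y. ?e u * ?v u)"
      unfolding sum.distrib swap by (simp add: sum_distrib_left)
    also have "\<dots> = 2 * (?e w * ?v w) + (\<Sum>u\<in>ioo w y. ?e u * ?v u)"
      using ico(2) unfolding ico(1) by (simp add: distrib_left)
    finally have "2 * (?e w * ?v w) + (\<Sum>u\<in>ioo w y. ?e u * ?v u) = - 2" ..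
    moreover have "(\<Sum>z\<in>ioo w y. g z) = (\<Sum>z\<in>ioo w y. ?v z) + (\<Sum>z\<in>ioo w y. ?e z * ?v z)"
      by (simp add: g_def distrib_right sum.distrib)
    moreover have "2 * g w = 2 * ?v w + 2 * (?e w * ?v w)" by (simp add: g_def algebra_simps)
    ultimately show ?thesis using rec[of w] by (simp add: algebra_simps)
  qed
  have "g w = 0" if "w \<sqsubset> y" for w
    using that
  proof (induction "len w y" arbitrary: w rule: less_induct)
    case less
    have "(\<Sum>z\<in>ioo w y. g z) = 0"
      by (rule sum.neutral) (use less ioo_len_less in \<open>auto simp: ioo_def\<close>)
    then show ?case using gsum[OF less.prems] by simp
  qed
  from this[OF assms(1)] show ?thesis using assms(2) by (simp add: g_def)
qed

text \<open>The operator sending F(x) to 2 F(x) plus the sum of t ^ len(x, z) F(z) over x < z < y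
  takes Y and 2 Psi to the same function. It is triangular with 2 on the diagonal, hence Y = 2 Psi,
  and by induction Y is visibly a cd-polynomial. Multiples are written as repeated sums, so that
  ring laws alone rearrange them.\<close>

lemma Psi_in_cd_span:
  assumes "x \<sqsubset> y" shows "Psi x y \<in> (cd_span :: 'k::field_char_0 R_Psi set)"
proof -
  let ?t = "\<lambda>k. amb ^ k :: 'k R_Psi"
  let ?c = "cd_letter_to_ab c_letter :: 'k R_Psi" and ?b = "letter b_letter :: 'k R_Psi"
  define V where "V x y = scale (cayley x y) (?t (len x y - 1))" for x y
  \<comment> \<open>Twice the right-hand side of \<Psi> = V + V c \<Psi> / 2, which avoids the
    fraction.\<close>
  define Y where "Y x = V x y + V x y + (\<Sum>w\<in>ioo x y. V x w * (?c * Psi w y))" for x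
  have powers: "?t (len x z) * ?t (len z y - 1) = ?t (len x y - 1)" if "z \<in> ioo x y" for x y z
  proof -
    have "len x z + (len z y - 1) = len x y - 1"
      using that len_add[of x z y] len_pos[of z y] by (auto simp: ioo_def)
    then show ?thesis by (metis power_add)
  qed
  have V: "V x y + V x y + (\<Sum>z\<in>ioo x y. ?t (len x z) * V z y) = ?t (len x y - 1) + ?t (len x y - 1)" for x y
  proof -
    have "(\<Sum>z\<in>ioo x y. ?t (len x z) * V z y) = (\<Sum>z\<in>ioo x y. scale (cayley z y) (?t (len x y - 1)))"
      by (intro sum.cong refl) (simp add: V_def times_scale powers del: One_nat_def)
    also have "\<dots> = scale (\<Sum>z\<in>ioo x y. cayley z y) (?t (len x y - 1))"
      by (simp add: pm.scale_sum_left)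
    finally have "V x y + V x y + (\<Sum>z\<in>ioo x y. ?t (len x z) * V z y) =
        scale (cayley x y + cayley x y + (\<Sum>z\<in>ioo x y. cayley z y)) (?t (len x y - 1))"
      by (simp only: V_def pm.scale_left_distrib)
    also have "cayley x y + cayley x y + (\<Sum>z\<in>ioo x y. cayley z y) = (1 + 1 :: 'k)"
      by (subst (1 2) cayley.simps) simp
    finally show ?thesis by (simp only: pm.scale_left_distrib pm.scale_one)
  qed
  \<comment> \<open>Either the length is even and the coefficient vanishes, or it is odd and t
    occurs to the even power len - 1.\<close>
  have V_cd: "V x w * q \<in> cd_span" if "x \<sqsubset> w" "q \<in> cd_span" for x w q
  proof (cases "even (len x w)")
    case True
    then show ?thesis by (simp add: V_def cayley_even[OF that(1)] cd_span_zero)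
  next
    case False
    then obtain k where "len x w = 2 * k + 1" by (auto elim: oddE)
    then show ?thesis by (simp add: V_def scale_times cd_span_scale cd_span_amb_even that(2))
  qed
  \<comment> \<open>In c = t + 2 b, the part t raises the power of t to the full length, giving the
    terms of the operator applied to 2 Psi; the part 2 b restores the sum in
    \<open>Psi_rec\<close>.\<close>
  have c: "?c = amb + ?b + ?b" by (simp add: amb_def)
  have Y_rec: "Y x + Y x + (\<Sum>z\<in>ioo x y. ?t (len x z) * Y z) =
      (Psi x y + Psi x y) + (Psi x y + Psi x y) + (\<Sum>z\<in>ioo x y. ?t (len x z) * (Psi z y + Psi z y))" for x
  proof -
    let ?p = "?t (len x y - 1)"
    have "(\<Sum>z\<in>ioo x y. ?t (len x z) * Y z) = (\<Sum>z\<in>ioo x y. ?t (len x z) * V z y) + (\<Sum>z\<in>ioo x y. ?t (len x z) * V z y)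
      + (\<Sum>z\<in>ioo x y. \<Sum>w\<in>ioo z y. ?t (len x z) * V z w * (?c * Psi w y))"
      unfolding Y_def by (simp only: distrib_left sum.distrib sum_distrib_left mult.assoc)
    also have "(\<Sum>z\<in>ioo x y. \<Sum>w\<in>ioo z y. ?t (len x z) * V z w * (?c * Psi w y))
      = (\<Sum>w\<in>ioo x y. (\<Sum>z\<in>ioo x w. ?t (len x z) * V z w) * (?c * Psi w y))"
      by (simp only: sum_ioo_swap sum_distrib_right)
    finally have "Y x + Y x + (\<Sum>z\<in>ioo x y. ?t (len x z) * Y z) =
       (V x y + V x y + (\<Sum>z\<in>ioo x y. ?t (len x z) * V z y)) + (V x y + V x y + (\<Sum>z\<in>ioo x y. ?t (len x z) * V z y)) +
       (\<Sum>w\<in>ioo x y. (V x w + V x w + (\<Sum>z\<in>ioo x w. ?t (len x z) * V z w)) * (?c * Psi w y))"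
      by (simp only: Y_def distrib_right sum.distrib add_ac)
    also have "\<dots> = (?p + ?p) + (?p + ?p) + (\<Sum>w\<in>ioo x y. (?t (len x w - 1) + ?t (len x w - 1)) * (?c * Psi w y))"
      by (simp only: V)
    also have "(\<Sum>w\<in>ioo x y. (?t (len x w - 1) + ?t (len x w - 1)) * (?c * Psi w y)) =
       (\<Sum>w\<in>ioo x y. ?t (len x w) * (Psi w y + Psi w y) + 
         (?t (len x w - 1) * ?b * Psi w y + ?t (len x w - 1) * ?b * Psi w y + 
         (?t (len x w - 1) * ?b * Psi w y + ?t (len x w - 1) * ?b * Psi w y)))"
    proof (rule sum.cong[OF refl])
      fix w assume "w \<in> ioo x y"
      then have "0 < len x w" by (intro len_pos) (auto simp: ioo_def)
      then have "?t (len x w) = ?t (len x w - 1) * amb"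
        by (metis Suc_pred' power_Suc2)
      then show "(?t (len x w - 1) + ?t (len x w - 1)) * (?c * Psi w y) = ?t (len x w) * (Psi w y + Psi w y) + 
         (?t (len x w - 1) * ?b * Psi w y + ?t (len x w - 1) * ?b * Psi w y + 
         (?t (len x w - 1) * ?b * Psi w y + ?t (len x w - 1) * ?b * Psi w y))"
        unfolding c by (simp only: distrib_left distrib_right mult.assoc add_ac)
    qed
    finally show ?thesis
      by (subst (1 2 3 4) Psi_rec) (simp only: sum.distrib add_ac)
  qed
  have Y: "Y x = Psi x y + Psi x y" if "x \<sqsubset> y" for x
    using that
  proof (induction "len x y" arbitrary: x rule: less_induct)
    case less
    have "(\<Sum>z\<in>ioo x y. ?t (len x z) * Y z) = (\<Sum>z\<in>ioo x y. ?t (len x z) * (Psi z y + Psi z y))"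
    proof (rule sum.cong[OF refl])
      fix z assume z: "z \<in> ioo x y"
      have "Y z = Psi z y + Psi z y" using z by (intro less.hyps ioo_len_less) (auto simp: ioo_def)
      then show "?t (len x z) * Y z = ?t (len x z) * (Psi z y + Psi z y)" by simp
    qed
    then have "Y x + Y x = (Psi x y + Psi x y) + (Psi x y + Psi x y)"
      using Y_rec[of x] by simp
    \<comment> \<open>Characteristic 0 allows the factor 2 to be cancelled.\<close>
    then have "scale 2 (Y x) = scale 2 (Psi x y + Psi x y)"
      by (simp only: one_add_one[symmetric] pm.scale_left_distrib pm.scale_one)
    then show ?case by (simp only: pm.scale_cancel_left) simp
  qed
  show ?thesis
    using assms
  proof (induction "len x y" arbitrary: x rule: less_induct)
    case less
    have "V x y \<in> cd_span" using V_cd[OF less.prems cd_span_one] by simp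
    moreover have "V x w * (?c * Psi w y) \<in> cd_span" if w: "w \<in> ioo x y" for w
    proof (intro V_cd cd_span_letter)
      show "Psi w y \<in> (cd_span :: 'k R_Psi set)" using w by (intro less.hyps ioo_len_less) (auto simp: ioo_def)
    qed (use w in \<open>auto simp: ioo_def\<close>)
    ultimately have "Y x \<in> cd_span"
      unfolding Y_def by (intro cd_span_add cd_span_sum)
    moreover have "Psi x y = scale (1/2) (Y x)"
      unfolding Y[OF less.prems] by (rule poly_mapping_eqI) (simp add: lookup_add)
    ultimately show ?case by (simp only: cd_span_scale)
  qed
qed

end


section \<open>The coproduct and the coaction\<close>

lemma tensor_sum_left: "sum f A \<otimes>\<^sub>K q = (\<Sum>a\<in>A. f a \<otimes>\<^sub>K q)"
  by (simp add: tensor_lin lin_ext_sum)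

context bounded_eulerian_poset begin

lemma Phi_interval:
  assumes "x \<sqsubseteq> y"
  shows "Phi (interval r x y) =
    (if x = y then Poly_Mapping.single e_letter 1 else add_e (Psi x y :: 'k::field_char_0 R_Psi))"
proof (cases "x = y")
  case True
  then have "poset_rank (interval r x y) = 0"
    using assms by (auto dest: le_in simp flip: len_def)
  then show ?thesis using True by (simp add: Phi_def cde_index_def cde_to_abe_def)
next
  case False
  then have xy: "x \<sqsubset> y" using assms by simp
  then have "poset_rank (interval r x y) > 0" using len_pos by (simp add: len_def)
  then have "Phi (interval r x y) = (add_e (ab_index (boundary (interval r x y))) :: 'k R_Psi_e)"
    by (rule Phi_eq_ab_index) (simp only: ab_index_boundary[OF xy] Psi_in_cd_span[OF xy])
  then show ?thesis using False by (simp only: ab_index_boundary[OF xy] if_False)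
qed

lemma coproduct_Phi:
  assumes "x \<sqsubseteq> y"
  shows "coproduct (Phi (interval r x y) :: 'k::field_char_0 R_Psi_e) =
    (\<Sum>z\<in>icc x y. Phi (interval r x z) \<otimes>\<^sub>K Phi (interval r z y))"
proof (cases "x = y")
  case True
  have "icc x x = {x}" using assms by (auto simp: icc_def intro: le_antisym dest: le_in)
  then show ?thesis
    using True assms by (simp add: Phi_interval coproduct_def tensor_single)
next
  case False
  have xx: "x \<sqsubseteq> x" "y \<sqsubseteq> y" using assms le_in le_refl by blast+
  have icc: "icc x y = insert x (insert y (ioo x y))" and nin: "x \<notin> ioo x y" "y \<notin> ioo x y"
    using False assms xx by (auto simp: icc_def ioo_def)
  have mid: "Phi (interval r x z) \<otimes>\<^sub>K Phi (interval r z y) = add_e (Psi x z) \<otimes>\<^sub>K add_e (Psi z y :: 'k R_Psi)"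
    if "z \<in> ioo x y" for z
    using that by (auto simp: ioo_def Phi_interval)
  show ?thesis
    unfolding icc using False assms xx nin
    by (simp add: Phi_interval coproduct_add_e lin_ext_mid_Psi mid add_ac cong: sum.cong)
qed

end

text \<open>Descent on the number of elements below x. Applied to the order and to its converse, it
  turns unique minimal and maximal elements into least and greatest ones.\<close>

lemma minimal_below:
  assumes "finite (Field r)" "Partial_order r" "x \<in> Field r"
  obtains m where "m \<in> minimal_elements r" "(m, x) \<in> r"
proof -
  have po: "(a, b) \<in> r \<Longrightarrow> (b, c) \<in> r \<Longrightarrow> (a, c) \<in> r" "(a, b) \<in> r \<Longrightarrow> (b, a) \<in> r \<Longrightarrow> a = b"
    "a \<in> Field r \<Longrightarrow> (a, a) \<in> r" for a b c
    using assms(2) by (auto simp: order_on_defs refl_on_def dest: transD antisymD)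
  have fin: "finite {y. (y, z) \<in> r}" for z
    by (rule finite_subset[OF _ assms(1)]) (auto simp: Field_def)
  have "\<exists>m\<in>minimal_elements r. (m, x) \<in> r"
    using assms(3)
  proof (induction "card {y. (y, x) \<in> r}" arbitrary: x rule: less_induct)
    case less
    show ?case
    proof (cases "x \<in> minimal_elements r")
      case True
      then show ?thesis using po(3)[OF less.prems] by blast
    next
      case False
      then obtain y where y: "(y, x) \<in> r" "y \<noteq> x" using less.prems by (auto simp: minimal_elements_def)
      have "{z. (z, y) \<in> r} \<subset> {z. (z, x) \<in> r}"
      proof
        show "{z. (z, y) \<in> r} \<subseteq> {z. (z, x) \<in> r}" using y po(1) by blast
        have "x \<in> {z. (z, x) \<in> r}" "x \<notin> {z. (z, y) \<in> r}" using y po(2,3) less.prems by blast+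
        then show "{z. (z, y) \<in> r} \<noteq> {z. (z, x) \<in> r}" by blast
      qed
      then have "card {z. (z, y) \<in> r} < card {z. (z, x) \<in> r}" by (rule psubset_card_mono[OF fin])
      moreover have "y \<in> Field r" using y by (auto simp: Field_def)
      ultimately obtain m where "m \<in> minimal_elements r" "(m, y) \<in> r" using less.hyps by blast
      then show ?thesis using y po(1) by blast
    qed
  qed
  then show thesis using that by blast
qed

lemma eulerian_bounded:
  assumes "eulerian r"
  obtains n where "bounded_eulerian_poset r (bot_of r) (top_of r) n"
proof -
  obtain n where r: "finite (Field r)" "Partial_order r" "\<exists>!x. x \<in> minimal_elements r"
      "\<exists>!x. x \<in> maximal_elements r" "has_rank r n"
    using assms by (auto simp: eulerian_def graded_poset_def has_bot_def has_top_def)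
  have bot: "bot_of r \<in> minimal_elements r" "\<And>x. x \<in> minimal_elements r \<Longrightarrow> x = bot_of r"
    using r(3) unfolding bot_of_def by (metis theI)+
  have top: "top_of r \<in> maximal_elements r" "\<And>x. x \<in> maximal_elements r \<Longrightarrow> x = top_of r"
    using r(4) unfolding top_of_def by (metis theI)+
  have conv: "minimal_elements (r\<inverse>) = maximal_elements r"
    by (auto simp: minimal_elements_def maximal_elements_def)
  interpret bounded_graded_poset r "bot_of r" "top_of r" n
  proof
    fix x assume x: "x \<in> Field r"
    show "(bot_of r, x) \<in> r" using minimal_below[OF r(1,2) x] bot(2) by metis
    obtain m where "m \<in> minimal_elements (r\<inverse>)" "(m, x) \<in> r\<inverse>"
      using minimal_below[of "r\<inverse>" x] r x by auto
    then show "(x, top_of r) \<in> r" using top(2) by (auto simp: conv)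
  qed (fact r)+
  have "bounded_eulerian_poset r (bot_of r) (top_of r) n"
  proof
    fix x y assume xy: "x \<sqsubset> y"
    have "card {z \<in> icc x y. even (len (bot_of r) z)} = card {z \<in> icc x y. odd (len (bot_of r) z)}"
      using assms xy len_pos[OF xy] by (simp add: eulerian_def len_def rk_def)
    moreover have "(\<Sum>z\<in>icc x y. (-1 :: int) ^ len (bot_of r) z) =
       (\<Sum>z\<in>icc x y. if even (len (bot_of r) z) then 1 else -1)"
      by (rule sum.cong) auto
    moreover have "{z. P z} \<inter> icc x y = {z \<in> icc x y. P z}" "icc x y \<inter> {z. P z} = {z \<in> icc x y. P z}" for P by auto
    moreover have "icc x y \<inter> - {z. even (len (bot_of r) z)} = {z \<in> icc x y. odd (len (bot_of r) z)}" by auto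
    ultimately show "(\<Sum>z\<in>icc x y. (-1 :: int) ^ len (bot_of r) z) = 0"
      by (simp add: sum.If_cases)
  qed
  then show thesis by (rule that)
qed

section \<open>The coaction on mixed cd-indices\<close>

lemma coaction_tensor:
  assumes "coproduct q = (\<Sum>i\<in>I. p i \<otimes>\<^sub>K s i)"
  shows "coaction (q' \<otimes>\<^sub>K q) = (\<Sum>i\<in>I. (q' \<otimes>\<^sub>K p i) \<otimes>\<^sub>K s i)"
proof -
  have "coaction (q' \<otimes>\<^sub>K q) = lin_ext (\<lambda>w'. prime_act w' (coproduct q)) q'"
    by (rule lin_ext_eqI)
      (simp_all only: coaction_tensor_single,
       simp_all add: coaction_def lin_ext_add lin_ext_scale tensor_add_left tensor_scale_left)
  also have "\<dots> = lin_ext (\<lambda>w'. \<Sum>i\<in>I. (Poly_Mapping.single w' 1 \<otimes>\<^sub>K p i) \<otimes>\<^sub>K s i) q'"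
    unfolding assms by (simp only: prime_act_tensor[symmetric]) (simp only: prime_act_def lin_ext_sum)
  also have "\<dots> = (\<Sum>i\<in>I. (q' \<otimes>\<^sub>K p i) \<otimes>\<^sub>K s i)"
    by (rule lin_ext_eqI[symmetric])
      (simp_all add: tensor_add_left tensor_scale_left sum.distrib pm.scale_sum_right)
  finally show ?thesis .
qed

text \<open>As b is least, [b, x] contains everything below x, and x' lies below x. Thus the
  restriction of \<phi> over [b, x] has the same subposets, hence the same local cd-indices, as
  \<phi>.\<close>

lemma sub_over_sub_over:
  assumes "refl_on (Field \<Gamma>) \<Gamma>" "trans B" "(x', x) \<in> B"
    and "\<And>y. y \<in> Field B \<Longrightarrow> (b, y) \<in> B"
  shows "sub_over \<phi> (sub_over \<phi> \<Gamma> B x) (interval B b x) x' = sub_over \<phi> \<Gamma> B x'"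
proof -
  have "(\<phi> y, x') \<in> interval B b x \<longleftrightarrow> (\<phi> y, x') \<in> B" for y
    using assms(2-4) by (auto simp: interval_def Field_def dest: transD)
  moreover have "(\<phi> y, x) \<in> B" if "(\<phi> y, x') \<in> B" for y
    using assms(2,3) that by (auto dest: transD)
  ultimately show ?thesis
    by (auto simp: sub_over_def Field_Restr_refl[OF assms(1)])
qed

context bounded_graded_poset begin

lemma top_of_interval:
  assumes "x \<sqsubseteq> y" shows "top_of (interval r x y) = y"
proof -
  have "maximal_elements (interval r x y) = {y}"
    using assms le_refl[of y] le_in[of x y]
    by (auto simp: maximal_elements_def) (auto simp: interval_def icc_def intro: le_antisym)
  then show ?thesis by (simp add: top_of_def)
qed

end

theorem theorem6p8:
  fixes \<Gamma> :: "'a rel" and B :: "'b rel" and \<phi> :: "'a \<Rightarrow> 'b"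
  assumes "lower_eulerian \<Gamma>"
    and "eulerian B"
    and "strong_formal_subdivision \<Gamma> B \<phi>"
  shows "coaction (mixed_cd_index \<phi> \<Gamma> B :: 'k::field_char_0 R_Omega_ambient) =
    (\<Sum>x \<in> Field B.
       mixed_cd_index \<phi> (sub_over \<phi> \<Gamma> B x) (interval B (bot_of B) x) \<otimes>\<^sub>K
       Phi (interval B x (top_of B)))"
proof -
  obtain n where "bounded_eulerian_poset B (bot_of B) (top_of B) n"
    using eulerian_bounded[OF assms(2)] .
  then interpret bounded_eulerian_poset B "bot_of B" "top_of B" n .
  let ?l = "\<lambda>x. local_cd_index (sub_over \<phi> \<Gamma> B x) :: 'k R_Phi"
  let ?g = "\<lambda>x z. (?l x \<otimes>\<^sub>K Phi (interval B x z)) \<otimes>\<^sub>K Phi (interval B z (top_of B))"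
  have refl: "refl_on (Field \<Gamma>) \<Gamma>"
    using assms(1) by (auto simp: lower_eulerian_def graded_poset_def order_on_defs)
  have trans: "trans B" using po by (auto simp: order_on_defs)
  have "coaction (mixed_cd_index \<phi> \<Gamma> B) =
      (\<Sum>x\<in>Field B. coaction (?l x \<otimes>\<^sub>K Phi (interval B x (top_of B))))"
    by (simp add: mixed_cd_index_def coaction_def lin_ext_sum)
  also have "\<dots> = (\<Sum>x\<in>Field B. \<Sum>z\<in>{z \<in> Field B. (x, z) \<in> B}. ?g x z)"
  proof (rule sum.cong[OF HOL.refl])
    fix x assume x: "x \<in> Field B"
    have "{z \<in> Field B. (x, z) \<in> B} = icc x (top_of B)"
      by (auto simp: icc_def le_tp dest: le_in)
    then show "coaction (?l x \<otimes>\<^sub>K Phi (interval B x (top_of B))) = (\<Sum>z\<in>{z \<in> Field B. (x, z) \<in> B}. ?g x z)"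
      by (simp only: coaction_tensor[OF coproduct_Phi[OF le_tp[OF x]]])
  qed
  \<comment> \<open>The sum runs over pairs x \<le> z; with z outermost, the inner sum over x in
    [0, z] is the mixed cd-index of the restriction over z.\<close>
  also have "\<dots> = (\<Sum>z\<in>Field B. \<Sum>x\<in>{x \<in> Field B. (x, z) \<in> B}. ?g x z)"
    by (rule sum.swap_restrict[OF fin fin])
  also have "\<dots> = (\<Sum>z\<in>Field B.
      mixed_cd_index \<phi> (sub_over \<phi> \<Gamma> B z) (interval B (bot_of B) z) \<otimes>\<^sub>K Phi (interval B z (top_of B)))"
  proof (rule sum.cong[OF HOL.refl])
    fix z assume z: "z \<in> Field B"
    have "{x \<in> Field B. (x, z) \<in> B} = icc (bot_of B) z"
      by (auto simp: icc_def bt_le dest: le_in)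
    moreover have "local_cd_index (sub_over \<phi> (sub_over \<phi> \<Gamma> B z) (interval B (bot_of B) z) x) \<otimes>\<^sub>K
        Phi (interval (interval B (bot_of B) z) x z) = ?l x \<otimes>\<^sub>K Phi (interval B x z)"
      if "x \<in> icc (bot_of B) z" for x
      using that z by (simp add: icc_def interval_interval sub_over_sub_over[OF refl trans _ bt_le])
    ultimately show "(\<Sum>x\<in>{x \<in> Field B. (x, z) \<in> B}. ?g x z) =
        mixed_cd_index \<phi> (sub_over \<phi> \<Gamma> B z) (interval B (bot_of B) z) \<otimes>\<^sub>K Phi (interval B z (top_of B))"
      by (simp add: mixed_cd_index_def top_of_interval[OF bt_le[OF z]] tensor_sum_left cong: sum.cong)
  qed
  finally show ?thesis .
qed

end
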